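(* Let $d\ge 1$, $a,w_1,\dots,w_d\in\mathcal H$, and $\bm w=(w_1,\dots,w_d)$. Then the derivative at $\alpha=0$ of the Barnes zeta function is $$\begin{aligned} \zeta_{\rm B}'(0,a|\bm w)={}&(-1)^{d+1}\sum_{m=0}^{d}\frac{{}_dS_m^{(d)}(0)\,a^{d-m}}{m!\,(d-m)!}\bigl(\log a-H_{d-m}\bigr)\\ &+\sum_{\bm n\in\mathbb N_0^d}\Biggl[-\log(a+\bm n\cdot\bm w)-H_d\\ &\qquad+\sum_{m=0}^{d}\frac{{}_dS_m^{(d)}(0)}{m!\,(d-m)!}G\bigl[(a+\bm n\cdot\bm w+x)^{d-m}\log(a+\bm n\cdot\bm w+x)\bigr]_{x=\bm w}\Biggr]. \end{aligned}$$
   Context: $\mathcal H=\{z\in\mathbb C:\theta-\frac{\pi}{2}<\arg z<\theta+\frac{\pi}{2}\}$ is a fixed open half-plane ($\theta$ a fixed real angle), and $\log$ is a fixed holomorphic branch of the logarithm on $\mathcal H$; $z^s=\exp(s\log z)$ for $z\in\mathcal H$. $\mathbb N_0=\{0,1,2,\dots\}$ and $\bm n\cdot\bm w=\sum_{i=1}^d n_iw_i$. The Barnes zeta function is $\zeta_{\rm B}(\alpha,a|\bm w)=\sum_{\bm n\in\mathbb N_0^d}(a+\bm n\cdot\bm w)^{-\alpha}$ for $\Re(\alpha)>d$; it extends meromorphically in $\alpha$ to $\mathbb C$, with at most simple poles, located at $\alpha=1,\dots,d$. The prime in $\zeta_{\rm B}'$ denotes the derivative with respect to $\alpha$. For $\bm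 v\in\mathbb C^d$ and a function $g$ of $x$, $G[g(x)]_{x=\bm v}=\sum_{S\subseteq\{1,\dots,d\}}(-1)^{d-|S|}g\bigl(\sum_{i\in S}v_i\bigr)$ (the empty set contributes $(-1)^dg(0)$). Harmonic numbers: $H_k=\sum_{i=1}^k 1/i$, $H_0=0$. The higher order Bernoulli polynomials $B_n(a|\bm w)$ are defined by $z^d{\rm e}^{az}\prod_{i=1}^d\frac{w_i}{{\rm e}^{w_iz}-1}=\sum_{n\ge0}B_n(a|\bm w)\frac{z^n}{n!}$ for $|z|<2\pi/\max_i|w_i|$. The Bernoullian functions ${}_dS_n(a)$ ($n\ge0$; dependence on $\bm w$ suppressed) are the polynomials in $a$ with ${}_dS_n(0)=0$ and ${}_dS_n'(a)=\frac{n!}{(n+d-1)!\,\prod_{i=1}^dw_i}B_{n+d-1}(a|\bm w)$; ${}_dS_m^{(d)}(0)$ is the $d$-th derivative in $a$ at $a=0$ (equivalently ${}_dS_m^{(d)}(0)=B_m(0|\bm w)/\prod_{i=1}^dw_i$). The sum over $\mathbb N_0^d$ is understood as an unordered (absolutely convergent) sum of the bracketed terms. *)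

theory Defs
  imports "HOL-Complex_Analysis.Complex_Analysis"
begin

text \<open>The open half-plane \<open>\<theta> - \<pi>/2 < arg z < \<theta> + \<pi>/2\<close>; the condition on the
  (multivalued) argument is read as: some value of \<open>arg z\<close> lies in that interval.\<close>

definition half_plane :: "real \<Rightarrow> complex set" where
  "half_plane \<theta> = {of_real r * cis t | r t. r > 0 \<and> \<theta> - pi / 2 < t \<and> t < \<theta> + pi / 2}"

definition log_branch_on :: "(complex \<Rightarrow> complex) \<Rightarrow> complex set \<Rightarrow> bool" where
  "log_branch_on lg H \<longleftrightarrow> lg holomorphic_on H \<and> (\<forall>z\<in>H. exp (lg z) = z)"

definition branch_powr :: "(complex \<Rightarrow> complex) \<Rightarrow> complex \<Rightarrow> complex \<Rightarrow> complex" where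
  "branch_powr lg z s = exp (s * lg z)"

text \<open>\<open>d\<close>-tuples are functions on \<open>{1..d}\<close>. The extensionality built into \<open>PiE\<close> makes
  every element of \<open>\<nat>\<^sub>0\<^sup>d\<close> occur exactly once as an index of summation.\<close>

definition nat_tuples :: "nat \<Rightarrow> (nat \<Rightarrow> nat) set" where
  "nat_tuples d = PiE {1..d} (\<lambda>_. UNIV)"

definition dot :: "nat \<Rightarrow> (nat \<Rightarrow> nat) \<Rightarrow> (nat \<Rightarrow> complex) \<Rightarrow> complex" where
  "dot d n w = (\<Sum>i=1..d. of_nat (n i) * w i)"

text \<open>The meromorphic continuation to \<open>\<complex>\<close> of the multiple series. The predicate
  \<open>nicely_meromorphic_on\<close> fixes the value \<open>0\<close> at poles and excludes removable singularities,
  so that there is at most one such function.\<close>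

definition barnes_zeta ::
    "(complex \<Rightarrow> complex) \<Rightarrow> nat \<Rightarrow> (nat \<Rightarrow> complex) \<Rightarrow> complex \<Rightarrow> complex \<Rightarrow> complex" where
  "barnes_zeta lg d w a = (THE f. f nicely_meromorphic_on UNIV \<and>
     (\<forall>\<alpha>. Re \<alpha> > real d \<longrightarrow>
        f \<alpha> = (\<Sum>\<^sub>\<infinity>n\<in>nat_tuples d. branch_powr lg (a + dot d n w) (- \<alpha>))))"

definition G_op :: "nat \<Rightarrow> (complex \<Rightarrow> complex) \<Rightarrow> (nat \<Rightarrow> complex) \<Rightarrow> complex" where
  "G_op d g v = (\<Sum>S\<in>Pow {1..d}. (- 1) ^ (d - card S) * g (\<Sum>i\<in>S. v i))"

text \<open>The Taylor coefficients are determined by the generating function on the punctured disc.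
  The centre is left out because the quotients \<open>w\<^sub>i / (exp (w\<^sub>i z) - 1)\<close> have
  removable singularities there, which HOL's convention \<open>x / 0 = 0\<close> would not fill in.\<close>

definition higher_bernoulli :: "nat \<Rightarrow> (nat \<Rightarrow> complex) \<Rightarrow> nat \<Rightarrow> complex \<Rightarrow> complex" where
  "higher_bernoulli d w n a =
     (THE B :: nat \<Rightarrow> complex.
        \<forall>z. z \<noteq> 0 \<and> norm z < 2 * pi / Max ((\<lambda>i. norm (w i)) ` {1..d}) \<longrightarrow>
          (\<lambda>k. B k * z ^ k / fact k) sums
            (z ^ d * exp (a * z) * (\<Prod>i=1..d. w i / (exp (w i * z) - 1)))) n"

definition bernoullian :: "nat \<Rightarrow> (nat \<Rightarrow> complex) \<Rightarrow> nat \<Rightarrow> complex poly" where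
  "bernoullian d w n =
     (THE p. poly p 0 = 0 \<and>
        (\<forall>a. poly (pderiv p) a =
           fact n / (fact (n + d - 1) * (\<Prod>i=1..d. w i)) * higher_bernoulli d w (n + d - 1) a))"

definition bernoullian_deriv0 :: "nat \<Rightarrow> (nat \<Rightarrow> complex) \<Rightarrow> nat \<Rightarrow> complex" where
  "bernoullian_deriv0 d w m = poly ((pderiv ^^ d) (bernoullian d w m)) 0"

end

theory Submission
  imports Defs
begin

text \<open>
  Put \<open>D = d/dx\<close> and let \<open>\<Sum> \<gamma>\<^sub>m X\<^sup>m\<close> be the formal inverse of \<open>\<Prod> (exp (w\<^sub>i X) - 1) / X\<close>, so that
  \<open>\<gamma>\<^sub>m\<close> is the \<open>d\<close>-th derivative of the \<open>m\<close>-th Bernoullian function at 0, divided by \<open>m!\<close>.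
  The operator \<open>G\<close> is the iterated difference \<open>\<Prod> (exp (w\<^sub>i D) - 1)\<close>, which is formally inverted
  by \<open>\<Sum> \<gamma>\<^sub>m D\<^sup>m\<^sup>-\<^sup>d\<close>. Truncating that series at \<open>m = M\<close> and applying it to \<open>x\<^sup>-\<^sup>\<alpha>\<close> gives a
  function \<open>K\<close> (here \<open>em_primitive\<close>, cleared of its poles in \<open>\<alpha>\<close>) for which
  \<open>y\<^sup>-\<^sup>\<alpha> - G[K(y + x)]\<close> is, by Taylor's formula, \<open>O(|y|\<^sup>-\<^sup>\<alpha>\<^sup>-\<^sup>M\<^sup>-\<^sup>1)\<close>, while the sum of
  \<open>G[K(a + n \<cdot> w + x)]\<close> over all \<open>n\<close> telescopes to \<open>(-1)\<^sup>d K(a)\<close>.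
  This continues the zeta function to \<open>Re \<alpha> > d - 1 - M\<close>. The case \<open>M = d\<close> covers \<open>\<alpha> = 0\<close>, where
  the series converges locally uniformly and may be differentiated term by term; since \<open>G\<close>
  annihilates polynomials of degree below \<open>d\<close>, only \<open>H\<^sub>d\<close> survives of the harmonic numbers
  inside the sum.
\<close>

section \<open>Higher order Bernoulli numbers as formal power series coefficients\<close>

definition diff_quot_fps :: "complex \<Rightarrow> complex fps" where
  "diff_quot_fps w = fps_shift 1 (fps_exp w - 1)"

text \<open>For nonzero \<open>w i\<close>, the coefficient of \<open>X ^ m\<close> is the higher
  order Bernoulli number at 0 divided by \<open>fact m\<close> and by the product of the
  \<open>w i\<close>; compare \<open>higher_bernoulli_eq\<close> at \<open>a = 0\<close>.\<close>

definition bernoulli_fps :: "nat \<Rightarrow> (nat \<Rightarrow> complex) \<Rightarrow> complex fps" where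
  "bernoulli_fps d w = (\<Prod>i=1..d. inverse (diff_quot_fps (w i)))"

lemma fps_exp_minus_one: "fps_exp w - 1 = fps_X * diff_quot_fps w"
  by (rule fps_ext) (simp add: diff_quot_fps_def)

lemma diff_quot_fps_nth_0: "fps_nth (diff_quot_fps w) 0 = w"
  by (simp add: diff_quot_fps_def)

lemma bernoulli_fps_nth_0: "fps_nth (bernoulli_fps d w) 0 = inverse (\<Prod>i=1..d. w i)"
  unfolding bernoulli_fps_def
  by (induction d) (simp_all add: diff_quot_fps_nth_0)

lemma bernoulli_fps_mult_exp_diff:
  assumes "\<And>i. i \<in> {1..d} \<Longrightarrow> w i \<noteq> 0"
  shows "bernoulli_fps d w * (\<Prod>i=1..d. fps_exp (w i) - 1) = fps_X ^ d"
proof -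
  have "bernoulli_fps d w * (\<Prod>i=1..d. fps_exp (w i) - 1) =
      (\<Prod>i=1..d. inverse (diff_quot_fps (w i)) * (fps_X * diff_quot_fps (w i)))"
    unfolding bernoulli_fps_def fps_exp_minus_one by (simp add: prod.distrib)
  also have "\<dots> = (\<Prod>i=1..d. fps_X)"
  proof (rule prod.cong)
    fix i assume "i \<in> {1..d}"
    then have "inverse (diff_quot_fps (w i)) * diff_quot_fps (w i) = 1"
      by (intro inverse_mult_eq_1) (use assms diff_quot_fps_nth_0 in auto)
    then show "inverse (diff_quot_fps (w i)) * (fps_X * diff_quot_fps (w i)) = fps_X"
      by (metis mult.left_commute mult.right_neutral)
  qed simp
  finally show ?thesis by simp
qed

text \<open>Expanding the product over subsets gives the alternating sum of exponentials of subset
  sums. This links \<open>G_op\<close> to formal power series.\<close>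

lemma prod_exp_diff_nth:
  "fps_nth (\<Prod>i=1..d. fps_exp (w i) - 1 :: complex fps) j = G_op d (\<lambda>x. x ^ j) w / fact j"
proof -
  have *: "(\<Prod>i\<in>S. fps_exp (w i) :: complex fps) = fps_exp (\<Sum>i\<in>S. w i)" for S
    by (induction S rule: infinite_finite_induct) (simp_all add: fps_exp_add_mult)
  have "(\<Prod>i=1..d. fps_exp (w i) - 1 :: complex fps) =
      (\<Sum>S\<in>Pow {1..d}. (\<Prod>i\<in>S. fps_exp (w i)) * (\<Prod>i\<in>{1..d} - S. - 1))"
    using prod_add[of "{1..d}" "\<lambda>i. fps_exp (w i)" "\<lambda>_. - 1 :: complex fps"] by simp
  also have "\<dots> = (\<Sum>S\<in>Pow {1..d}. fps_const ((- 1) ^ (d - card S)) * fps_exp (\<Sum>i\<in>S. w i))"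
  proof (rule sum.cong)
    fix S assume "S \<in> Pow {1..d}"
    then have "card ({1..d} - S) = d - card S"
      by (subst card_Diff_subset) (auto intro: finite_subset)
    then show "(\<Prod>i\<in>S. fps_exp (w i)) * (\<Prod>i\<in>{1..d} - S. - 1) =
        fps_const ((- 1) ^ (d - card S)) * fps_exp (\<Sum>i\<in>S. w i)"
      by (simp add: * fps_const_power[symmetric] fps_const_neg[symmetric] mult.commute
            del: fps_const_power fps_const_neg)
  qed simp
  finally show ?thesis
    by (simp add: fps_sum_nth G_op_def sum_divide_distrib)
qed

text \<open>Comparison of the coefficients of \<open>X ^ k\<close> in
  \<open>bernoulli_fps_mult_exp_diff\<close>: in this form \<open>bernoulli_fps\<close> inverts
  \<open>G_op\<close>.\<close>

lemma G_op_power_convolution: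
  assumes "\<And>i. i \<in> {1..d} \<Longrightarrow> w i \<noteq> 0"
  shows "(\<Sum>m\<le>k. fps_nth (bernoulli_fps d w) m * (G_op d (\<lambda>x. x ^ (k - m)) w / fact (k - m)))
    = (if k = d then 1 else 0)"
proof -
  have "fps_nth (bernoulli_fps d w * (\<Prod>i=1..d. fps_exp (w i) - 1)) k = (if k = d then 1 else 0)"
    using bernoulli_fps_mult_exp_diff[OF assms] by simp
  then show ?thesis
    by (simp add: fps_mult_nth prod_exp_diff_nth atMost_atLeast0 del: One_nat_def)
qed

lemma prod_exp_diff_eq:
  fixes d :: nat
  shows "(\<Prod>i=1..d. fps_exp (w i) - 1 :: complex fps) = fps_X ^ d * (\<Prod>i=1..d. diff_quot_fps (w i))"
  unfolding fps_exp_minus_one by (simp add: prod.distrib)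

lemma prod_diff_quot_fps_nth_0:
  fixes d :: nat
  shows "fps_nth (\<Prod>i=1..d. diff_quot_fps (w i)) 0 = (\<Prod>i=1..d. w i)"
  by (induction d) (simp_all add: diff_quot_fps_nth_0)

text \<open>The product of the \<open>fps_exp (w i) - 1\<close> starts in degree \<open>d\<close>,
  with the product of the \<open>w i\<close> as its leading coefficient.\<close>

lemma G_op_power:
  assumes "k \<le> d"
  shows "G_op d (\<lambda>x. x ^ k) w = (if k = d then fact d * (\<Prod>i=1..d. w i) else 0)"
  using prod_exp_diff_nth[where d=d and w=w and j=k] assms unfolding prod_exp_diff_eq fps_X_power_mult_nth
  by (auto simp: prod_diff_quot_fps_nth_0 field_simps simp del: One_nat_def split: if_splits)

lemma G_op_sum: "G_op d (\<lambda>x. \<Sum>j\<in>J. f j x) w = (\<Sum>j\<in>J. G_op d (f j) w)"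
  unfolding G_op_def by (subst sum.swap) (simp add: sum_distrib_left)

lemma G_op_cmult: "G_op d (\<lambda>x. c * f x) w = c * G_op d f w"
  by (simp add: G_op_def sum_distrib_left algebra_simps)

lemma G_op_diff: "G_op d (\<lambda>x. f x - g x) w = G_op d f w - G_op d g w"
  by (simp add: G_op_def sum_subtractf algebra_simps)

text \<open>In the binomial expansion every power of \<open>x\<close> below \<open>d\<close> is
  annihilated, so up to degree \<open>d\<close> the shift by \<open>y\<close> has no effect.\<close>

lemma G_op_shifted_power:
  assumes "k \<le> d"
  shows "G_op d (\<lambda>x. (y + x) ^ k) w = (if k = d then fact d * (\<Prod>i=1..d. w i) else 0)"
proof -
  have "G_op d (\<lambda>x. (y + x) ^ k) w =
      (\<Sum>j\<le>k. of_nat (k choose j) * y ^ (k - j) * G_op d (\<lambda>x. x ^ j) w)"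
    by (subst add.commute, subst binomial_ring)
       (simp add: G_op_sum G_op_cmult[symmetric] mult_ac)
  also have "\<dots> = (\<Sum>j\<le>k. if j = k then G_op d (\<lambda>x. x ^ j) w else 0)"
    by (rule sum.cong) (use assms in \<open>auto simp: G_op_power\<close>)
  also have "\<dots> = G_op d (\<lambda>x. x ^ k) w" by simp
  finally show ?thesis using assms by (simp add: G_op_power)
qed

section \<open>Bernoullian derivatives at 0 as formal coefficients\<close>

lemma exp_eq_1_small:
  fixes z :: complex
  assumes "exp z = 1" "norm z < 2 * pi"
  shows "z = 0"
proof -
  obtain n :: int where n: "Re z = 0" "Im z = of_int (2 * n) * pi"
    using assms(1) by (auto simp: exp_eq_1)
  have "\<bar>of_int (2 * n) * pi\<bar> < 2 * pi"
    using assms(2) abs_Im_le_cmod[of z] n by linarith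
  then have "\<bar>real_of_int n\<bar> < 1" by (simp add: abs_mult)
  then have "n = 0" by linarith
  then show ?thesis using n by (simp add: complex_eq_iff)
qed

text \<open>The centre is omitted to match \<open>higher_bernoulli\<close>, so the constant
  coefficients are compared by a limit at 0 before uniqueness of expansions applies.\<close>

lemma powser_coeff_unique:
  fixes A B :: "nat \<Rightarrow> complex"
  assumes "r > 0"
    and A: "\<And>z. z \<noteq> 0 \<Longrightarrow> norm z < r \<Longrightarrow> (\<lambda>k. A k * z ^ k) sums f z"
    and B: "\<And>z. z \<noteq> 0 \<Longrightarrow> norm z < r \<Longrightarrow> (\<lambda>k. B k * z ^ k) sums f z"
  shows "A = B"
proof -
  let ?F = "Abs_fps (\<lambda>k. A k - B k)"
  have "(\<lambda>_. 0) has_fps_expansion ?F"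
  proof (rule has_fps_expansionI)
    have lim: "((\<lambda>_. 0) \<longlongrightarrow> A 0 - B 0) (at (0::complex))"
    proof (rule powser_limit_0_strong[OF \<open>r > 0\<close>])
      fix z :: complex assume "z \<noteq> 0" "norm z < r"
      from sums_diff[OF A[OF this] B[OF this]]
      show "(\<lambda>n. (A n - B n) * z ^ n) sums 0" by (simp add: algebra_simps)
    qed
    then have 0: "A 0 - B 0 = 0" by (simp add: tendsto_const_iff)
    have "eventually (\<lambda>z :: complex. z \<in> ball 0 r) (nhds 0)"
      using \<open>r > 0\<close> by (intro eventually_nhds_in_open) auto
    then show "\<forall>\<^sub>F z in nhds 0. (\<lambda>n. fps_nth ?F n * z ^ n) sums 0"
    proof eventually_elim
      case (elim z)
      show ?case
      proof (cases "z = 0")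
        case True
        then show ?thesis using 0 powser_sums_zero[of "\<lambda>n. A n - B n"] by simp
      next
        case False
        with elim sums_diff[OF A B, of z z] show ?thesis by (simp add: algebra_simps)
      qed
    qed
  qed
  then have "?F = 0" by (metis fps_expansion_unique_complex has_fps_expansion_0)
  then show ?thesis by (auto simp: fps_eq_iff fun_eq_iff)
qed

text \<open>With the singularity at 0 filled in, each \<open>(exp (w i * z) - 1) / z\<close> is
  entire and has no zero in the given disc. The product of the inverses is therefore holomorphic
  there, and its expansion at 0 converges on the whole disc.\<close>

lemma bernoulli_generating_function_sums:
  assumes d: "d \<ge> 1" and w: "\<And>i. i \<in> {1..d} \<Longrightarrow> w i \<noteq> 0"
    and z: "z \<noteq> 0" "norm z < 2 * pi / Max ((\<lambda>i. norm (w i)) ` {1..d})"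
  shows "(\<lambda>k. fps_nth (fps_const (\<Prod>i=1..d. w i) * fps_exp a * bernoulli_fps d w) k * z ^ k) sums
    (z ^ d * exp (a * z) * (\<Prod>i=1..d. w i / (exp (w i * z) - 1)))"
proof -
  define R where "R = 2 * pi / Max ((\<lambda>i. norm (w i)) ` {1..d})"
  \<comment> \<open>The value \<open>u\<close> fills the removable singularity; the exponent 1 is
    spelled out to fit the shape of \<open>has_fps_expansion_shift\<close>.\<close>
  define \<psi> where "\<psi> = (\<lambda>u z :: complex. if z = 0 then u else (exp (u * z) - 1) / z ^ 1)"
  have Mx: "norm (w i) \<le> Max ((\<lambda>i. norm (w i)) ` {1..d})" if "i \<in> {1..d}" for i
    using that by (intro Max_ge) auto
  have Mpos: "Max ((\<lambda>i. norm (w i)) ` {1..d}) > 0"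
    by (rule less_le_trans[OF _ Mx[of 1]]) (use w[of 1] d in auto)
  have \<psi>exp: "\<psi> u has_fps_expansion diff_quot_fps u" if "u \<noteq> 0" for u
  proof -
    have sd: "1 \<le> subdegree (fps_exp u - 1)"
      using that by (intro subdegree_geI) (auto simp: fps_eq_iff intro: exI[of _ 1])
    show ?thesis
      unfolding \<psi>_def diff_quot_fps_def
      by (rule has_fps_expansion_shift) (use sd in \<open>auto intro!: fps_expansion_intros\<close>)
  qed
  have \<psi>holo: "\<psi> u holomorphic_on UNIV" if "u \<noteq> 0" for u
  proof -
    have "\<psi> u analytic_on {z}" for z
    proof (cases "z = 0")
      case True
      then show ?thesis using \<psi>exp[OF that] has_fps_expansion_imp_analytic_0 by blast
    next
      case False
      have "(\<lambda>z. (exp (u * z) - 1) / z ^ 1) holomorphic_on - {0}"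
        by (intro holomorphic_intros) auto
      then have "\<psi> u holomorphic_on - {0}"
        by (rule holomorphic_transform) (auto simp: \<psi>_def)
      then show ?thesis using False by (intro holomorphic_on_imp_analytic_at) auto
    qed
    then show ?thesis
      using analytic_imp_holomorphic analytic_on_analytic_at by blast
  qed
  have \<psi>nz: "\<psi> (w i) z \<noteq> 0" if i: "i \<in> {1..d}" and z: "norm z < R" for i z
  proof (cases "z = 0")
    case True
    then show ?thesis using w[OF i] by (simp add: \<psi>_def)
  next
    case False
    have "norm (w i * z) \<le> Max ((\<lambda>i. norm (w i)) ` {1..d}) * norm z"
      using Mx[OF i] by (simp add: norm_mult mult_right_mono)
    also have "\<dots> < 2 * pi" using z Mpos by (simp add: R_def field_simps)
    finally show ?thesis
      using exp_eq_1_small[of "w i * z"] False w[OF i] by (auto simp: \<psi>_def)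
  qed
  define \<phi> where "\<phi> = (\<lambda>z. (\<Prod>i=1..d. w i) * exp (a * z) * (\<Prod>i=1..d. inverse (\<psi> (w i) z)))"
  have "\<phi> has_fps_expansion fps_const (\<Prod>i=1..d. w i) * fps_exp a * bernoulli_fps d w"
    unfolding \<phi>_def bernoulli_fps_def
    by (intro fps_expansion_intros \<psi>exp) (use w in \<open>auto simp: diff_quot_fps_nth_0\<close>)
  moreover have "\<phi> holomorphic_on eball 0 (ereal R)"
    unfolding \<phi>_def using \<psi>nz
    by (auto intro!: holomorphic_intros holomorphic_on_subset[OF \<psi>holo] w)
  ultimately have "(\<lambda>k. fps_nth (fps_const (\<Prod>i=1..d. w i) * fps_exp a * bernoulli_fps d w) k * z ^ k)
      sums \<phi> z"
    by (rule has_fps_expansion_imp_sums_complex) (use z in \<open>auto simp: R_def\<close>)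
  also have "\<phi> z = z ^ d * exp (a * z) * (\<Prod>i=1..d. w i / (exp (w i * z) - 1))"
    using z by (simp add: \<phi>_def \<psi>_def prod_dividef prod.distrib divide_inverse prod_inversef)
  finally show ?thesis .
qed

text \<open>Uniqueness of Taylor coefficients evaluates the definite description; the sum is the
  Cauchy product of \<open>bernoulli_fps\<close> with \<open>fps_exp a\<close>.\<close>

lemma higher_bernoulli_eq:
  assumes d: "d \<ge> 1" and w: "\<And>i. i \<in> {1..d} \<Longrightarrow> w i \<noteq> 0"
  shows "higher_bernoulli d w n a =
    fact n * (\<Prod>i=1..d. w i) * (\<Sum>k\<le>n. fps_nth (bernoulli_fps d w) k * a ^ (n - k) / fact (n - k))"
proof -
  define R where "R = 2 * pi / Max ((\<lambda>i. norm (w i)) ` {1..d})"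
  define F where "F = fps_const (\<Prod>i=1..d. w i) * fps_exp a * bernoulli_fps d w"
  have "norm (w 1) > 0" using w[of 1] d by auto
  then have Mpos: "Max ((\<lambda>i. norm (w i)) ` {1..d}) > 0"
    using d by (subst Max_gr_iff) (auto intro!: bexI[of _ 1])
  then have "R > 0" by (simp add: R_def)
  have F: "(\<lambda>k. fps_nth F k * z ^ k) sums
      (z ^ d * exp (a * z) * (\<Prod>i=1..d. w i / (exp (w i * z) - 1)))"
    if "z \<noteq> 0" "norm z < R" for z
    unfolding F_def using bernoulli_generating_function_sums[OF d w] that by (simp add: R_def)
  have "(THE B :: nat \<Rightarrow> complex. \<forall>z. z \<noteq> 0 \<and> norm z < 2 * pi / Max ((\<lambda>i. norm (w i)) ` {1..d}) \<longrightarrow>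
          (\<lambda>k. B k * z ^ k / fact k) sums
            (z ^ d * exp (a * z) * (\<Prod>i=1..d. w i / (exp (w i * z) - 1)))) = (\<lambda>k. fact k * fps_nth F k)"
  proof (rule the_equality)
    show "\<forall>z. z \<noteq> 0 \<and> norm z < 2 * pi / Max ((\<lambda>i. norm (w i)) ` {1..d}) \<longrightarrow>
          (\<lambda>k. (fact k * fps_nth F k) * z ^ k / fact k) sums
            (z ^ d * exp (a * z) * (\<Prod>i=1..d. w i / (exp (w i * z) - 1)))"
      using F by (simp add: R_def)
  next
    fix B :: "nat \<Rightarrow> complex"
    assume B: "\<forall>z. z \<noteq> 0 \<and> norm z < 2 * pi / Max ((\<lambda>i. norm (w i)) ` {1..d}) \<longrightarrow>
          (\<lambda>k. B k * z ^ k / fact k) sums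
            (z ^ d * exp (a * z) * (\<Prod>i=1..d. w i / (exp (w i * z) - 1)))"
    have "(\<lambda>k. B k / fact k) = fps_nth F"
      by (rule powser_coeff_unique[OF \<open>R > 0\<close> _ F]) (use B in \<open>simp add: R_def\<close>)
    then show "B = (\<lambda>k. fact k * fps_nth F k)"
      by (metis (no_types) fact_nonzero nonzero_mult_div_cancel_left times_divide_eq_right)
  qed
  then have "higher_bernoulli d w n a = fact n * fps_nth F n"
    by (simp add: higher_bernoulli_def)
  also have "F = fps_const (\<Prod>i=1..d. w i) * (bernoulli_fps d w * fps_exp a)"
    by (simp add: F_def mult_ac)
  also have "fps_nth \<dots> n = (\<Prod>i=1..d. w i) *
      (\<Sum>k\<le>n. fps_nth (bernoulli_fps d w) k * a ^ (n - k) / fact (n - k))"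
    unfolding fps_mult_left_const_nth fps_mult_nth[of "bernoulli_fps d w"] by (simp add: atMost_atLeast0)
  finally show ?thesis by (simp add: mult.assoc)
qed

text \<open>The Bernoulli polynomial is integrated term by term, and the \<open>d\<close>-th
  derivative at 0 reads off the coefficient of degree \<open>d\<close>.\<close>

lemma bernoullian_deriv0_eq:
  assumes d: "d \<ge> 1" and w: "\<And>i. i \<in> {1..d} \<Longrightarrow> w i \<noteq> 0"
  shows "bernoullian_deriv0 d w m = fact m * fps_nth (bernoulli_fps d w) m"
proof -
  define N where "N = m + d - 1"
  define \<gamma> where "\<gamma> = fps_nth (bernoulli_fps d w)"
  \<comment> \<open>The factorial of \<open>N\<close> and the product of the \<open>w i\<close> in
    \<open>bernoullian\<close> cancel against those in \<open>higher_bernoulli_eq\<close>, leaving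
    \<open>fact m\<close>. No constant term occurs, which fixes the constant of integration.\<close>
  define p :: "complex poly" where
    "p = smult (fact m) (\<Sum>k\<le>N. monom (\<gamma> k / fact (N - k + 1)) (N - k + 1))"
  have W: "(\<Prod>i=1..d. w i) \<noteq> 0" using w by simp
  have "poly (pderiv p) a = fact m * (\<Sum>k\<le>N. \<gamma> k * a ^ (N - k) / fact (N - k))" for a
  proof -
    have "1 + of_nat (N - k) \<noteq> (0 :: complex)" for k
      by (metis of_nat_Suc of_nat_neq_0)
    then have *: "pderiv (monom (\<gamma> k / fact (N - k + 1)) (N - k + 1)) = monom (\<gamma> k / fact (N - k)) (N - k)" for k
      unfolding pderiv_monom by (simp add: fact_reduce)
    show ?thesis
      unfolding p_def pderiv_smult higher_pderiv_sum[of 1, simplified] poly_smult poly_sum * poly_monom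
      by simp
  qed
  then have p: "poly (pderiv p) a =
      fact m / (fact (m + d - 1) * (\<Prod>i=1..d. w i)) * higher_bernoulli d w (m + d - 1) a" for a
    using W higher_bernoulli_eq[of d w N a] d w
    by (simp add: N_def[symmetric] \<gamma>_def[symmetric] del: One_nat_def)
  have p0: "poly p 0 = 0"
    by (simp add: p_def poly_sum poly_monom)
  have "bernoullian d w m = p"
    unfolding bernoullian_def
  proof (rule the_equality)
    fix q :: "complex poly"
    assume q: "poly q 0 = 0 \<and> (\<forall>a. poly (pderiv q) a =
      fact m / (fact (m + d - 1) * (\<Prod>i=1..d. w i)) * higher_bernoulli d w (m + d - 1) a)"
    then have "poly (pderiv q) = poly (pderiv p)" by (simp add: p fun_eq_iff)
    then have "pderiv (q - p) = 0" by (simp add: poly_eq_poly_eq_iff pderiv_diff)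
    then obtain c where "q - p = [:c:]" by (metis pderiv_iszero)
    moreover have "poly (q - p) 0 = 0" using q p0 by simp
    ultimately show "q = p" by simp
  qed (use p p0 in auto)
  moreover have "poly ((pderiv ^^ d) p) 0 = fact d * coeff p d"
    by (simp add: poly_0_coeff_0 coeff_higher_pderiv pochhammer_fact)
  moreover have "coeff p d = fact m * (\<Sum>k\<le>N. if k = m then \<gamma> k / fact d else 0)"
  proof -
    have "coeff (monom (\<gamma> k / fact (N - k + 1)) (N - k + 1)) d = (if k = m then \<gamma> k / fact d else 0)"
      if "k \<le> N" for k
    proof -
      have "N - k + 1 = d \<longleftrightarrow> k = m" using that d by (auto simp: N_def)
      then show ?thesis by (metis coeff_monom)
    qed
    then show ?thesis by (simp add: p_def coeff_sum)
  qed
  moreover have "m \<le> N" using d by (simp add: N_def)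
  ultimately show ?thesis
    by (simp add: bernoullian_deriv0_def \<gamma>_def)
qed

section \<open>Branches of the logarithm on a half-plane\<close>

text \<open>Rotation by \<open>- \<theta>\<close> carries the half-plane to the right half-plane.
  The linear description yields openness, convexity and closure under addition.\<close>

lemma half_plane_iff: "z \<in> half_plane \<theta> \<longleftrightarrow> 0 < Re (cis (- \<theta>) * z)"
proof
  assume "z \<in> half_plane \<theta>"
  then obtain r t where z: "z = of_real r * cis t" "r > 0" "\<theta> - pi / 2 < t" "t < \<theta> + pi / 2"
    by (auto simp: half_plane_def)
  have "cis (- \<theta>) * z = of_real r * cis (t - \<theta>)"
    by (simp add: z cis_mult mult.left_commute[of "cis (- \<theta>)"])
  moreover have "cos (t - \<theta>) > 0" using z by (intro cos_gt_zero_pi) auto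
  ultimately have "cis (- \<theta>) * z = of_real r * cis (t - \<theta>)" "r * cos (t - \<theta>) > 0"
    using z(2) by auto
  then show "0 < Re (cis (- \<theta>) * z)" by (simp only: times_complex.sel cis.sel complex_of_real_def complex.sel)
next
  define u where "u = cis (- \<theta>) * z"
  assume "0 < Re (cis (- \<theta>) * z)"
  then have Arg: "\<bar>Arg u\<bar> < pi / 2" unfolding Arg_Re_pos u_def by blast
  have "z = cis \<theta> * u" by (simp add: u_def cis_mult mult.assoc[symmetric])
  also have "u = of_real (norm u) * cis (Arg u)"
    using rcis_cmod_Arg[of u] by (simp add: rcis_def)
  finally have "z = of_real (norm u) * cis (\<theta> + Arg u)"
    by (metis cis_mult mult.left_commute)
  moreover have "norm u > 0" using \<open>0 < Re _\<close> by (auto simp: u_def)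
  ultimately show "z \<in> half_plane \<theta>"
    unfolding half_plane_def using Arg
    by (intro CollectI exI[of _ "norm u"] exI[of _ "\<theta> + Arg u"]) auto
qed

lemma open_half_plane: "open (half_plane \<theta>)"
proof -
  have "half_plane \<theta> = {z. 0 < Re (cis (- \<theta>) * z)}" by (auto simp only: half_plane_iff)
  also have "open \<dots>" by (intro open_Collect_less continuous_intros)
  finally show ?thesis .
qed

lemma Re_mult_eq_inner: "Re (u * z) = inner (cnj u) z"
  by (simp add: inner_complex_def)

lemma convex_half_plane: "convex (half_plane \<theta>)"
proof -
  have "half_plane \<theta> = {z. inner (cnj (cis (- \<theta>))) z > 0}"
    unfolding Re_mult_eq_inner[symmetric] by (auto simp only: half_plane_iff)
  then show ?thesis by (simp only: convex_halfspace_gt)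
qed

lemma log_branch_DERIV:
  assumes "log_branch_on lg (half_plane \<theta>)" "z \<in> half_plane \<theta>"
  shows "(lg has_field_derivative 1 / z) (at z)"
proof -
  have D: "(lg has_field_derivative deriv lg z) (at z)"
    using assms open_half_plane by (auto simp: log_branch_on_def intro: holomorphic_derivI)
  have "((\<lambda>z. exp (lg z)) has_field_derivative exp (lg z) * deriv lg z) (at z)"
    using D by (auto intro!: derivative_eq_intros)
  then have "((\<lambda>z. z) has_field_derivative exp (lg z) * deriv lg z) (at z)"
    by (rule DERIV_cong_ev[THEN iffD1, rotated 3])
       (use assms eventually_nhds_in_open[OF open_half_plane assms(2)] in
         \<open>auto simp: log_branch_on_def elim!: eventually_mono\<close>)
  then have "exp (lg z) * deriv lg z = 1"
    using DERIV_unique DERIV_ident by blast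
  then have "deriv lg z = 1 / z"
    using assms by (metis log_branch_on_def nonzero_mult_div_cancel_left exp_not_eq_zero)
  then show ?thesis using D by simp
qed

lemma log_branch_Re:
  assumes "log_branch_on lg (half_plane \<theta>)" "z \<in> half_plane \<theta>"
  shows "Re (lg z) = ln (norm z)"
proof -
  have "norm (exp (lg z)) = norm z" using assms by (simp add: log_branch_on_def)
  then show ?thesis by (metis norm_exp_eq_Re ln_exp)
qed

text \<open>The principal logarithm of the rotated variable also has derivative
  \<open>1 / z\<close>, so it differs from \<open>lg\<close> by a constant on the convex half-plane,
  and its imaginary part stays below \<open>pi / 2\<close> in modulus.\<close>

lemma log_branch_Im_bounded:
  assumes "log_branch_on lg (half_plane \<theta>)"
  obtains C where "\<And>z. z \<in> half_plane \<theta> \<Longrightarrow> \<bar>Im (lg z)\<bar> \<le> C"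
proof -
  have "\<exists>c. \<forall>z\<in>half_plane \<theta>. lg z - Ln (cis (- \<theta>) * z) = c"
  proof (rule has_field_derivative_zero_constant[OF convex_half_plane])
    fix z assume z: "z \<in> half_plane \<theta>"
    then have pos: "0 < Re (cis (- \<theta>) * z)" by (simp only: half_plane_iff)
    then have *: "cis (- \<theta>) * z \<notin> \<real>\<^sub>\<le>\<^sub>0" "z \<noteq> 0"
      unfolding complex_nonpos_Reals_iff by (simp_all only: not_le de_Morgan_conj) auto
    have "((\<lambda>z. lg z - Ln (cis (- \<theta>) * z)) has_field_derivative
        1 / z - inverse (cis (- \<theta>) * z) * cis (- \<theta>)) (at z)"
    proof (rule DERIV_diff[OF log_branch_DERIV[OF assms z]])
      show "((\<lambda>z. Ln (cis (- \<theta>) * z)) has_field_derivative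
          inverse (cis (- \<theta>) * z) * cis (- \<theta>)) (at z)"
        by (rule DERIV_chain2[where f = Ln and g = "\<lambda>z. cis (- \<theta>) * z",
              OF has_field_derivative_Ln[OF *(1)] DERIV_cmult_Id])
    qed
    moreover have "1 / z - inverse (cis (- \<theta>) * z) * cis (- \<theta>) = 0"
      using *(2) by (simp add: field_simps del: cis_inverse)
    ultimately show "((\<lambda>z. lg z - Ln (cis (- \<theta>) * z)) has_field_derivative 0) (at z within half_plane \<theta>)"
      by (simp only: has_field_derivative_at_within)
  qed
  then obtain c where c: "lg z - Ln (cis (- \<theta>) * z) = c" if "z \<in> half_plane \<theta>" for z by blast
  show ?thesis
  proof (rule that)
    fix z assume z: "z \<in> half_plane \<theta>"
    then have "\<bar>Im (Ln (cis (- \<theta>) * z))\<bar> < pi / 2"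
      by (intro Re_Ln_pos_lt_imp) (simp only: half_plane_iff)
    moreover have "Im (lg z) = Im c + Im (Ln (cis (- \<theta>) * z))"
      using c[OF z] by (metis add.commute diff_add_cancel plus_complex.sel(2))
    ultimately show "\<bar>Im (lg z)\<bar> \<le> \<bar>Im c\<bar> + pi / 2" by linarith
  qed
qed

section \<open>Sums over lattice points\<close>

text \<open>Weierstrass: the M-test on closed discs makes the net of finite partial sums converge
  uniformly, which preserves holomorphy and allows termwise differentiation.\<close>

lemma holomorphic_infsum:
  fixes f :: "'i \<Rightarrow> complex \<Rightarrow> complex"
  assumes S: "open S" and holo: "\<And>n. n \<in> A \<Longrightarrow> f n holomorphic_on S"
    and bound: "\<And>K. compact K \<Longrightarrow> K \<subseteq> S \<Longrightarrow> K \<noteq> {} \<Longrightarrow>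
      \<exists>M. M summable_on A \<and> (\<forall>n\<in>A. \<forall>z\<in>K. norm (f n z) \<le> M n)"
  shows "(\<lambda>z. \<Sum>\<^sub>\<infinity>n\<in>A. f n z) holomorphic_on S"
    and "\<And>z. z \<in> S \<Longrightarrow> ((\<lambda>n. deriv (f n) z) has_sum deriv (\<lambda>z. \<Sum>\<^sub>\<infinity>n\<in>A. f n z) z) A"
proof -
  have *: "((\<lambda>z. \<Sum>\<^sub>\<infinity>n\<in>A. f n z) field_differentiable at z) \<and>
      ((\<lambda>n. deriv (f n) z) has_sum deriv (\<lambda>z. \<Sum>\<^sub>\<infinity>n\<in>A. f n z) z) A" if z: "z \<in> S" for z
  proof -
    obtain r where r: "r > 0" "cball z r \<subseteq> S" using S z open_contains_cball by blast
    then obtain M where M: "M summable_on A" "\<And>n w. n \<in> A \<Longrightarrow> w \<in> cball z r \<Longrightarrow> norm (f n w) \<le> M n"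
      using bound[of "cball z r"] by auto
    have ul: "uniform_limit (cball z r) (\<lambda>X w. \<Sum>n\<in>X. f n w) (\<lambda>w. \<Sum>\<^sub>\<infinity>n\<in>A. f n w)
        (finite_subsets_at_top A)"
      using M(2,1) by (rule Weierstrass_m_test_general)
    have "\<forall>\<^sub>F X in finite_subsets_at_top A. continuous_on (cball z r) (\<lambda>w. \<Sum>n\<in>X. f n w) \<and>
       (\<forall>w\<in>ball z r. ((\<lambda>w. \<Sum>n\<in>X. f n w) has_field_derivative (\<Sum>n\<in>X. deriv (f n) w)) (at w))"
    proof (rule eventually_finite_subsets_at_top_weakI)
      fix X assume X: "finite X" "X \<subseteq> A"
      then have "(\<lambda>w. \<Sum>n\<in>X. f n w) holomorphic_on S" by (intro holomorphic_intros holo) auto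
      moreover have "(f n has_field_derivative deriv (f n) w) (at w)" if "w \<in> ball z r" "n \<in> X" for n w
        using that r X by (intro holomorphic_derivI[OF holo S]) auto
      then have "((\<lambda>w. \<Sum>n\<in>X. f n w) has_field_derivative (\<Sum>n\<in>X. deriv (f n) w)) (at w)"
        if "w \<in> ball z r" for w
        using that by (intro DERIV_sum)
      ultimately show "continuous_on (cball z r) (\<lambda>w. \<Sum>n\<in>X. f n w) \<and>
         (\<forall>w\<in>ball z r. ((\<lambda>w. \<Sum>n\<in>X. f n w) has_field_derivative (\<Sum>n\<in>X. deriv (f n) w)) (at w))"
        using holomorphic_on_imp_continuous_on[OF holomorphic_on_subset[OF _ r(2)]] by blast
    qed
    from has_complex_derivative_uniform_limit[OF this ul _ \<open>r > 0\<close>] obtain g' where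
      g': "\<And>w. w \<in> ball z r \<Longrightarrow> ((\<lambda>w. \<Sum>\<^sub>\<infinity>n\<in>A. f n w) has_field_derivative g' w) (at w) \<and>
        ((\<lambda>X. \<Sum>n\<in>X. deriv (f n) w) \<longlongrightarrow> g' w) (finite_subsets_at_top A)"
      by auto
    from g'[of z] \<open>r > 0\<close> show ?thesis
      using DERIV_imp_deriv[of "\<lambda>w. \<Sum>\<^sub>\<infinity>n\<in>A. f n w" "g' z" z]
      by (auto simp: has_sum_def field_differentiable_def)
  qed
  show "(\<lambda>z. \<Sum>\<^sub>\<infinity>n\<in>A. f n z) holomorphic_on S"
    using * by (auto simp: holomorphic_on_def intro: field_differentiable_at_within)
  show "((\<lambda>n. deriv (f n) z) has_sum deriv (\<lambda>z. \<Sum>\<^sub>\<infinity>n\<in>A. f n z) z) A" if "z \<in> S" for z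
    using * that by blast
qed

section \<open>Convergence of power sums over the lattice\<close>

definition weight :: "nat \<Rightarrow> (nat \<Rightarrow> nat) \<Rightarrow> real" where
  "weight d n = 1 + (\<Sum>i=1..d. real (n i))"

lemma weight_ge_1: "weight d n \<ge> 1"
  by (simp add: weight_def sum_nonneg)

text \<open>Each \<open>1 + n i\<close> is at most the weight, so the summand is bounded by a
  product of one-dimensional terms with exponent \<open>\<sigma> / d > 1\<close>.\<close>

lemma summable_weight_powr:
  assumes d: "d \<ge> 1" and \<sigma>: "\<sigma> > real d"
  shows "(\<lambda>n. weight d n powr - \<sigma>) summable_on nat_tuples d"
proof (rule summable_on_comparison_test)
  define \<tau> where "\<tau> = \<sigma> / real d"
  have "\<tau> > 1" using assms by (simp add: \<tau>_def field_simps)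
  then have "summable (\<lambda>k. real (Suc k) powr - \<tau>)"
    using summable_real_powr_iff[of "- \<tau>"] by (subst summable_Suc_iff) auto
  then have "Infinite_Set_Sum.abs_summable_on (\<lambda>k. real (Suc k) powr - \<tau>) UNIV"
    by (simp add: abs_summable_on_nat_iff')
  then have "Infinite_Set_Sum.abs_summable_on (\<lambda>n. \<Prod>i\<in>{1..d}. real (Suc (n i)) powr - \<tau>) (nat_tuples d)"
    unfolding nat_tuples_def by (intro Infinite_Set_Sum.abs_summable_on_prod_PiE) auto
  then show "(\<lambda>n. \<Prod>i\<in>{1..d}. real (Suc (n i)) powr - \<tau>) summable_on nat_tuples d"
    unfolding abs_summable_equivalent[symmetric] by (rule abs_summable_summable)
  fix n
  have "(\<Prod>i=1..d. real (Suc (n i))) \<le> (\<Prod>i=1..d. weight d n)"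
  proof (rule prod_mono)
    fix i assume "i \<in> {1..d}"
    then show "0 \<le> real (Suc (n i)) \<and> real (Suc (n i)) \<le> weight d n"
      using member_le_sum[of i "{1..d}" "\<lambda>i. real (n i)"] by (auto simp: weight_def)
  qed
  then have "(\<Prod>i=1..d. real (Suc (n i))) \<le> weight d n powr real d"
    using weight_ge_1[of d n] by (simp add: powr_realpow)
  then have "(weight d n powr real d) powr - \<tau> \<le> (\<Prod>i=1..d. real (Suc (n i))) powr - \<tau>"
    using \<open>\<tau> > 1\<close> by (intro powr_mono2') (auto intro!: prod_pos)
  also have "(weight d n powr real d) powr - \<tau> = weight d n powr - \<sigma>"
    using d by (simp add: powr_powr \<tau>_def)
  finally show "weight d n powr - \<sigma> \<le> (\<Prod>i\<in>{1..d}. real (Suc (n i)) powr - \<tau>)"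
    by (simp add: prod_powr_distrib)
qed auto

section \<open>Telescoping of alternating lattice shifts\<close>

lemma has_sum_sum:
  fixes f :: "'a \<Rightarrow> 'b \<Rightarrow> complex"
  assumes "\<And>s. s \<in> F \<Longrightarrow> (f s has_sum T s) A"
  shows "((\<lambda>n. \<Sum>s\<in>F. f s n) has_sum (\<Sum>s\<in>F. T s)) A"
  using assms by (induction F rule: infinite_finite_induct) (auto intro!: has_sum_add)

lemma sum_Pow_sign:
  assumes "finite T"
  shows "(\<Sum>S\<in>Pow T. (- 1) ^ card S) = (if T = {} then 1 else (0 :: complex))"
proof -
  have "(\<Sum>S\<in>Pow T. (- 1) ^ card S) = (0 :: complex) ^ card T"
    using prod_add[OF assms, of "\<lambda>_. - 1" "\<lambda>_. 1 :: complex"] by simp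
  then show ?thesis using assms by (simp add: power_0_left)
qed

lemma sum_Pow_sign_subset:
  assumes "finite A" "T \<subseteq> A"
  shows "(\<Sum>S\<in>Pow A. (- 1) ^ (card A - card S) * (if S \<subseteq> T then c else 0)) =
    (if T = {} then (- 1) ^ card A * c else (0 :: complex))"
proof -
  have "(\<Sum>S\<in>Pow A. (- 1) ^ (card A - card S) * (if S \<subseteq> T then c else 0)) =
      (\<Sum>S\<in>Pow T. (- 1) ^ card A * c * (- 1) ^ card S)"
  proof (rule sum.mono_neutral_cong_right)
    fix S assume "S \<in> Pow T"
    then have "card S \<le> card A" using assms by (intro card_mono) auto
    then have "(- 1 :: complex) ^ card A = (- 1) ^ (card A - card S) * (- 1) ^ card S"
      by (simp flip: power_add)
    then show "(- 1) ^ (card A - card S) * (if S \<subseteq> T then c else 0) =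
        (- 1) ^ card A * c * (- 1) ^ card S"
      using \<open>S \<in> Pow T\<close> by (simp flip: power_mult_distrib)
  qed (use assms in auto)
  also have "\<dots> = (if T = {} then (- 1) ^ card A * c else 0)"
    using assms by (simp add: sum_distrib_left[symmetric] sum_Pow_sign finite_subset)
  finally show ?thesis .
qed

text \<open>The restriction to \<open>{1..d}\<close> keeps the shifted tuple extensional, hence
  inside \<open>nat_tuples d\<close>.\<close>

definition shift_tuple :: "nat \<Rightarrow> nat set \<Rightarrow> (nat \<Rightarrow> nat) \<Rightarrow> nat \<Rightarrow> nat" where
  "shift_tuple d S n = (\<lambda>i\<in>{1..d}. n i + of_bool (i \<in> S))"

text \<open>Summing over the shifts by \<open>S\<close> means summing over the tuples that are
  positive on \<open>S\<close>. By inclusion-exclusion only the tuple with empty support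
  survives.\<close>

lemma has_sum_alternating_shifts:
  fixes K :: "(nat \<Rightarrow> nat) \<Rightarrow> complex"
  assumes "K summable_on nat_tuples d"
  shows "((\<lambda>n. \<Sum>S\<in>Pow {1..d}. (- 1) ^ (d - card S) * K (shift_tuple d S n)) has_sum
    ((- 1) ^ d * K (\<lambda>i\<in>{1..d}. 0))) (nat_tuples d)"
proof -
  define supp where "supp n = {i\<in>{1..d}. n i > 0}" for n :: "nat \<Rightarrow> nat"
  define T where "T S = (\<Sum>\<^sub>\<infinity>n\<in>{n\<in>nat_tuples d. S \<subseteq> supp n}. K n)" for S
  have T: "(K has_sum T S) {n\<in>nat_tuples d. S \<subseteq> supp n}" for S
    unfolding T_def by (rule has_sum_infsum, rule summable_on_subset[OF assms]) auto
  have shift: "((\<lambda>n. K (shift_tuple d S n)) has_sum T S) (nat_tuples d)" if "S \<subseteq> {1..d}" for S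
  proof -
    have "((\<lambda>n. K (shift_tuple d S n)) has_sum T S) (nat_tuples d) \<longleftrightarrow>
        (K has_sum T S) {n\<in>nat_tuples d. S \<subseteq> supp n}"
      \<comment> \<open>Subtracting the indicator of \<open>S\<close> inverts the shift, since the
        entries on \<open>S\<close> are positive in the target set.\<close>
      by (rule has_sum_reindex_bij_witness[where j = "shift_tuple d S"
            and i = "\<lambda>n. \<lambda>i\<in>{1..d}. n i - of_bool (i \<in> S)"])
         (use that in \<open>auto simp: shift_tuple_def nat_tuples_def supp_def PiE_def extensional_def
            restrict_def subset_iff fun_eq_iff split: if_splits\<close>)
    then show ?thesis using T by blast
  qed
  \<comment> \<open>Extension by zero puts all the sums on one index set, so that the alternating
    sum over \<open>S\<close> can be taken pointwise in \<open>n\<close>.\<close>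
  have "((\<lambda>n. if S \<subseteq> supp n then K n else 0) has_sum T S) (nat_tuples d)" for S
    using T[of S] by (rule has_sum_cong_neutral[THEN iffD1, rotated -1]) auto
  then have "((\<lambda>n. \<Sum>S\<in>Pow {1..d}. (- 1) ^ (d - card S) * (if S \<subseteq> supp n then K n else 0)) has_sum
      (\<Sum>S\<in>Pow {1..d}. (- 1) ^ (d - card S) * T S)) (nat_tuples d)"
    by (intro has_sum_sum has_sum_cmult_right)
  then have 1: "((\<lambda>n. if supp n = {} then (- 1) ^ d * K n else 0) has_sum
      (\<Sum>S\<in>Pow {1..d}. (- 1) ^ (d - card S) * T S)) (nat_tuples d)"
  proof (rule has_sum_cong[THEN iffD1, rotated])
    fix n
    have "supp n \<subseteq> {1..d}" by (auto simp: supp_def)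
    then show "(\<Sum>S\<in>Pow {1..d}. (- 1) ^ (d - card S) * (if S \<subseteq> supp n then K n else 0)) =
        (if supp n = {} then (- 1) ^ d * K n else 0)"
      using sum_Pow_sign_subset[of "{1..d}" "supp n" "K n"] by simp
  qed
  have "((\<lambda>n. if supp n = {} then (- 1) ^ d * K n else 0) has_sum
      ((- 1) ^ d * K (\<lambda>i\<in>{1..d}. 0))) (nat_tuples d)"
  proof (rule has_sum_finite_neutralI)
    show "{\<lambda>i\<in>{1..d}. 0} \<subseteq> nat_tuples d" by (auto simp: nat_tuples_def)
    fix n assume "n \<in> nat_tuples d - {\<lambda>i\<in>{1..d}. 0}"
    then have "n \<in> extensional {1..d}" "n \<noteq> (\<lambda>i\<in>{1..d}. 0)"
      by (auto simp: nat_tuples_def PiE_def)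
    then have "\<exists>i\<in>{1..d}. n i \<noteq> 0"
      using extensionalityI[of n "{1..d}" "\<lambda>i\<in>{1..d}. 0"] by force
    then have "supp n \<noteq> {}" by (auto simp: supp_def)
    then show "(if supp n = {} then (- 1) ^ d * K n else 0) = 0" by simp
  qed (auto simp: supp_def)
  from has_sum_unique[OF 1 this]
  have 2: "(\<Sum>S\<in>Pow {1..d}. (- 1) ^ (d - card S) * T S) = (- 1) ^ d * K (\<lambda>i\<in>{1..d}. 0)" .
  show ?thesis unfolding 2[symmetric]
    by (intro has_sum_sum has_sum_cmult_right shift) auto
qed

lemma dot_shift_tuple:
  assumes "S \<subseteq> {1..d}"
  shows "dot d (shift_tuple d S n) w = dot d n w + (\<Sum>i\<in>S. w i)"
proof -
  have "dot d (shift_tuple d S n) w = (\<Sum>i=1..d. of_nat (n i) * w i + (if i \<in> S then w i else 0))"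
    unfolding dot_def shift_tuple_def by (rule sum.cong) (auto simp: algebra_simps)
  also have "\<dots> = dot d n w + (\<Sum>i\<in>{1..d} \<inter> S. w i)"
    by (simp add: sum.distrib dot_def sum.inter_restrict)
  also have "{1..d} \<inter> S = S" using assms by auto
  finally show ?thesis .
qed

text \<open>By the identity theorem the two functions agree on a punctured neighbourhood of every
  point; being nicely meromorphic then determines the value at the point itself.\<close>

lemma nicely_meromorphic_eqI:
  assumes f: "f nicely_meromorphic_on UNIV" and g: "g nicely_meromorphic_on UNIV"
    and U: "open U" "U \<noteq> {}" "\<And>z. z \<in> U \<Longrightarrow> f z = g z"
  shows "f = g"
proof -
  have mero: "(\<lambda>z. f z - g z) meromorphic_on UNIV"
    using f g by (auto simp: nicely_meromorphic_on_def intro: meromorphic_intros)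
  define h where "h = remove_sings (\<lambda>z. f z - g z)"
  have ev: "eventually (\<lambda>w. h w = f w - g w) (at z)" for z
    unfolding h_def using meromorphic_on_isolated_singularity[OF meromorphic_on_subset[OF mero]]
    by (intro eventually_remove_sings_eq_at) auto
  obtain z0 where "z0 \<in> U" using U by blast
  have "eventually (\<lambda>w. h w = 0) (at z0)"
    using ev eventually_at_in_open'[OF U(1) \<open>z0 \<in> U\<close>] by eventually_elim (use U in auto)
  then have "frequently (\<lambda>w. h w = 0) (at z0)"
    by (intro eventually_frequently) auto
  then have h0: "h w = 0" for w
    using frequently_eq_meromorphic_imp_constant[of h 0 z0 UNIV]
      remove_sings_nicely_meromorphic[OF mero] by (auto simp: h_def)
  show ?thesis
  proof
    fix z
    have eq: "eventually (\<lambda>w. f w = g w) (at z)"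
      using ev[of z] by eventually_elim (simp add: h0)
    then have pole: "is_pole f z \<longleftrightarrow> is_pole g z" by (intro is_pole_cong) auto
    have fz: "is_pole f z \<and> f z = 0 \<or> f \<midarrow>z\<rightarrow> f z" and gz: "is_pole g z \<and> g z = 0 \<or> g \<midarrow>z\<rightarrow> g z"
      using f g by (auto simp: nicely_meromorphic_on_def)
    show "f z = g z"
    proof (cases "is_pole f z")
      case True
      \<comment> \<open>At a pole there is no finite limit, so both functions take the default value
        0.\<close>
      then have "\<not> (f \<midarrow>z\<rightarrow> f z)" "\<not> (g \<midarrow>z\<rightarrow> g z)"
        using pole not_tendsto_and_filterlim_at_infinity[of "at z"] by (auto simp: is_pole_def)
      then show ?thesis using fz gz by auto
    next
      case False
      then have "f \<midarrow>z\<rightarrow> f z" "g \<midarrow>z\<rightarrow> g z" using fz gz pole by auto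
      then have "g \<midarrow>z\<rightarrow> f z" using tendsto_cong[OF eq] by blast
      then show ?thesis using \<open>g \<midarrow>z\<rightarrow> g z\<close> LIM_unique by blast
    qed
  qed
qed

text \<open>On a compact set the majorant uses the least real part and the largest value of
  \<open>D\<close>; since weights are at least 1, the least exponent dominates. The offset
  \<open>p\<close> serves both the zeta series (\<open>p = 0\<close>) and the remainder series
  (\<open>p = M + 1\<close>).\<close>

lemma holomorphic_weighted_infsum:
  fixes f :: "(nat \<Rightarrow> nat) \<Rightarrow> complex \<Rightarrow> complex" and p :: real
  assumes d: "d \<ge> 1" and S: "open S" "\<And>z. z \<in> S \<Longrightarrow> real d < Re z + p"
    and holo: "\<And>n. f n holomorphic_on S"
    and D: "continuous_on S D"
    and bound: "\<And>n z. z \<in> S \<Longrightarrow> norm (f n z) \<le> D z * weight d n powr - (Re z + p)"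
  shows "(\<lambda>z. \<Sum>\<^sub>\<infinity>n\<in>nat_tuples d. f n z) holomorphic_on S"
    and "\<And>z. z \<in> S \<Longrightarrow>
      ((\<lambda>n. deriv (f n) z) has_sum deriv (\<lambda>z. \<Sum>\<^sub>\<infinity>n\<in>nat_tuples d. f n z) z) (nat_tuples d)"
    and "\<And>z. z \<in> S \<Longrightarrow> (\<lambda>n. f n z) summable_on nat_tuples d"
proof -
  have bd: "\<exists>M. M summable_on nat_tuples d \<and> (\<forall>n\<in>nat_tuples d. \<forall>z\<in>K. norm (f n z) \<le> M n)"
    if K: "compact K" "K \<subseteq> S" "K \<noteq> {}" for K
  proof -
    have "continuous_on K Re" by (intro continuous_intros)
    then obtain z0 where z0: "z0 \<in> K" "\<And>z. z \<in> K \<Longrightarrow> Re z0 \<le> Re z"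
      using continuous_attains_inf[OF K(1,3), of Re] by auto
    have "continuous_on K D" using D K(2) continuous_on_subset by blast
    then obtain z1 where z1: "\<And>z. z \<in> K \<Longrightarrow> D z \<le> D z1"
      using continuous_attains_sup[OF K(1,3), of D] by auto
    \<comment> \<open>The absolute value secures the sign that \<open>mult_mono\<close> asks
      for.\<close>
    have "(\<lambda>n. \<bar>D z1\<bar> * weight d n powr - (Re z0 + p)) summable_on nat_tuples d"
      using S(2)[of z0] z0(1) K(2) by (intro summable_on_cmult_right summable_weight_powr d) auto
    moreover have "norm (f n z) \<le> \<bar>D z1\<bar> * weight d n powr - (Re z0 + p)" if "z \<in> K" for n z
    proof -
      have "norm (f n z) \<le> D z * weight d n powr - (Re z + p)" using bound that K(2) by blast
      also have "\<dots> \<le> \<bar>D z1\<bar> * weight d n powr - (Re z0 + p)"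
        using z0(2)[OF that] z1[OF that] weight_ge_1[of d n]
        by (intro mult_mono powr_mono) auto
      finally show ?thesis .
    qed
    ultimately show ?thesis by blast
  qed
  from holomorphic_infsum[where A = "nat_tuples d" and f = f, OF S(1) holo bd]
  show "(\<lambda>z. \<Sum>\<^sub>\<infinity>n\<in>nat_tuples d. f n z) holomorphic_on S"
    and "\<And>z. z \<in> S \<Longrightarrow>
      ((\<lambda>n. deriv (f n) z) has_sum deriv (\<lambda>z. \<Sum>\<^sub>\<infinity>n\<in>nat_tuples d. f n z) z) (nat_tuples d)"
    by auto
  show "(\<lambda>n. f n z) summable_on nat_tuples d" if "z \<in> S" for z
  proof -
    obtain M where M: "M summable_on nat_tuples d" "\<forall>n\<in>nat_tuples d. norm (f n z) \<le> M n"
      using bd[of "{z}"] \<open>z \<in> S\<close> by auto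
    then have "(\<lambda>n. norm (f n z)) summable_on nat_tuples d"
      by (intro summable_on_comparison_test[OF M(1)]) auto
    then show ?thesis by (rule abs_summable_summable)
  qed
qed

section \<open>Meromorphic continuation\<close>

locale barnes =
  fixes \<theta> :: real and lg :: "complex \<Rightarrow> complex" and d :: nat and w :: "nat \<Rightarrow> complex" and a :: complex
  assumes lg: "log_branch_on lg (half_plane \<theta>)"
    and d: "d \<ge> 1"
    and a: "a \<in> half_plane \<theta>"
    and w: "\<And>i. i \<in> {1..d} \<Longrightarrow> w i \<in> half_plane \<theta>"
begin

text \<open>Signed distance to the boundary line of the half-plane. Unlike the norm it is additive,
  and it bounds the norm from below.\<close>

definition height :: "complex \<Rightarrow> real" where
  "height z = Re (cis (- \<theta>) * z)"

definition pt :: "(nat \<Rightarrow> nat) \<Rightarrow> complex" where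
  "pt n = a + dot d n w"

text \<open>The falling factorial of \<open>d - \<alpha>\<close>. For \<open>j = d\<close> it is
  \<open>(1 - \<alpha>) ... (d - \<alpha>)\<close>, which clears the possible poles of the zeta
  function.\<close>

definition falling :: "nat \<Rightarrow> complex \<Rightarrow> complex" where
  "falling j \<alpha> = (\<Prod>i<j. of_nat d - of_nat i - \<alpha>)"

text \<open>The \<open>j\<close>-th derivative of \<open>z \<mapsto> z\<^bsup>d - \<alpha>\<^esup>\<close>; up to the factor \<open>falling d \<alpha>\<close> it is the
  \<open>(j - d)\<close>-th derivative of \<open>z\<^bsup>- \<alpha>\<^esup>\<close>, but without poles in \<open>\<alpha>\<close>.\<close>
definition pow_deriv :: "nat \<Rightarrow> complex \<Rightarrow> complex \<Rightarrow> complex" where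
  "pow_deriv j \<alpha> z = falling j \<alpha> * branch_powr lg z (of_nat d - of_nat j - \<alpha>)"

abbreviation \<gamma> :: "nat \<Rightarrow> complex" where
  "\<gamma> \<equiv> fps_nth (bernoulli_fps d w)"

definition em_primitive :: "nat \<Rightarrow> complex \<Rightarrow> complex \<Rightarrow> complex" where
  "em_primitive M \<alpha> z = (\<Sum>m\<le>M. \<gamma> m * pow_deriv m \<alpha> z)"

text \<open>Both terms carry the factor that clears the poles:
  \<open>pow_deriv d \<alpha> (pt n)\<close> is \<open>falling d \<alpha>\<close> times the zeta
  summand. Hence the remainder is entire in \<open>\<alpha>\<close>.\<close>

definition em_remainder :: "nat \<Rightarrow> (nat \<Rightarrow> nat) \<Rightarrow> complex \<Rightarrow> complex" where
  "em_remainder M n \<alpha> = pow_deriv d \<alpha> (pt n) - G_op d (\<lambda>x. em_primitive M \<alpha> (pt n + x)) w"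

section \<open>Heights of lattice points\<close>

lemma in_half_plane_iff: "z \<in> half_plane \<theta> \<longleftrightarrow> 0 < height z"
  by (simp only: half_plane_iff height_def)

lemma height_add: "height (x + y) = height x + height y"
  by (simp add: height_def algebra_simps)

lemma height_sum: "height (\<Sum>i\<in>A. f i) = (\<Sum>i\<in>A. height (f i))"
  unfolding height_def sum_distrib_left Re_sum ..

lemma height_of_nat_mult: "height (of_nat k * x) = of_nat k * height x"
  by (simp add: height_def algebra_simps)

lemma height_le_norm: "height z \<le> norm z"
proof -
  have "height z \<le> norm (cis (- \<theta>) * z)" unfolding height_def by (rule complex_Re_le_cmod)
  then show ?thesis by (simp add: norm_mult)
qed

lemma convex_height_ge: "convex {z. c \<le> height z}"
proof -
  have "{z. c \<le> height z} = {z. inner (cnj (cis (- \<theta>))) z \<ge> c}"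
    unfolding height_def Re_mult_eq_inner by auto
  then show ?thesis by (simp only: convex_halfspace_ge)
qed

lemma w_nonzero: "i \<in> {1..d} \<Longrightarrow> w i \<noteq> 0"
  using w[of i] by (auto simp: in_half_plane_iff height_def)

lemma sum_w_height: "S \<subseteq> {1..d} \<Longrightarrow> 0 \<le> height (\<Sum>i\<in>S. w i)"
  unfolding height_sum using w by (intro sum_nonneg less_imp_le) (auto simp: in_half_plane_iff subset_iff)

text \<open>Height is additive and positive on \<open>a\<close> and on every \<open>w i\<close>, so
  the least of these heights serves as \<open>\<delta>\<close>.\<close>

lemma height_pt_ge:
  obtains \<delta> where "\<delta> > 0" "\<And>n. \<delta> * weight d n \<le> height (pt n)"
proof
  define \<delta> where "\<delta> = Min (insert (height a) ((\<lambda>i. height (w i)) ` {1..d}))"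
  show "\<delta> > 0"
    unfolding \<delta>_def using a w by (subst Min_gr_iff) (auto simp: in_half_plane_iff)
  have \<delta>: "\<delta> \<le> height a" "\<And>i. i \<in> {1..d} \<Longrightarrow> \<delta> \<le> height (w i)"
    unfolding \<delta>_def by (rule Min_le; simp)+
  fix n
  have "\<delta> * weight d n = \<delta> + (\<Sum>i=1..d. real (n i) * \<delta>)"
    by (simp add: weight_def distrib_left sum_distrib_left mult.commute)
  also have "\<dots> \<le> height a + (\<Sum>i=1..d. real (n i) * height (w i))"
    using \<delta> by (intro add_mono sum_mono mult_left_mono) auto
  also have "\<dots> = height (pt n)"
    by (simp add: pt_def dot_def height_add height_sum height_of_nat_mult)
  finally show "\<delta> * weight d n \<le> height (pt n)" .
qed

lemma height_pt_pos: "0 < height (pt n)"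
proof -
  obtain \<delta> where "\<delta> > 0" "\<delta> * weight d n \<le> height (pt n)" using height_pt_ge by blast
  then show ?thesis using weight_ge_1[of d n]
    by (smt (verit) mult_pos_pos)
qed

lemma pt_in_half_plane: "pt n \<in> half_plane \<theta>"
  using height_pt_pos by (simp add: in_half_plane_iff)

lemma pt_add_in_half_plane: "S \<subseteq> {1..d} \<Longrightarrow> pt n + (\<Sum>i\<in>S. w i) \<in> half_plane \<theta>"
  using height_pt_pos[of n] sum_w_height[of S] by (simp add: in_half_plane_iff height_add)

section \<open>Bounds and derivatives of complex powers\<close>

lemma norm_branch_powr_le:
  obtains C where "\<And>z s. z \<in> half_plane \<theta> \<Longrightarrow>
    norm (branch_powr lg z s) \<le> norm z powr Re s * exp (C * \<bar>Im s\<bar>)"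
proof -
  obtain C where C: "\<And>z. z \<in> half_plane \<theta> \<Longrightarrow> \<bar>Im (lg z)\<bar> \<le> C"
    using log_branch_Im_bounded[OF lg] by blast
  show ?thesis
  proof (rule that)
    fix z s assume z: "z \<in> half_plane \<theta>"
    have "z \<noteq> 0" using z by (auto simp: in_half_plane_iff height_def)
    \<comment> \<open>The modulus of the power is
      \<open>exp (Re s * ln (norm z) - Im s * Im (lg z))\<close>, and the bounded imaginary part of
      \<open>lg\<close> controls the second term.\<close>
    have "- (Im s * Im (lg z)) \<le> \<bar>Im s\<bar> * \<bar>Im (lg z)\<bar>"
      using abs_ge_minus_self[of "Im s * Im (lg z)"] by (simp add: abs_mult)
    also have "\<dots> \<le> C * \<bar>Im s\<bar>"
      using C[OF z] by (metis abs_ge_zero mult.commute mult_left_mono)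
    finally have "exp (Re s * ln (norm z) - Im s * Im (lg z)) \<le> exp (Re s * ln (norm z) + C * \<bar>Im s\<bar>)"
      by simp
    then show "norm (branch_powr lg z s) \<le> norm z powr Re s * exp (C * \<bar>Im s\<bar>)"
      using \<open>z \<noteq> 0\<close> log_branch_Re[OF lg z]
      by (simp add: branch_powr_def norm_exp_eq_Re powr_def exp_add)
  qed
qed

text \<open>The last condition makes the real part of the exponent nonpositive, so
  \<open>norm z\<close> may be replaced by its lower bound \<open>T\<close>.\<close>

lemma norm_pow_deriv_le:
  obtains C where "\<And>z j \<alpha> T. 0 < T \<Longrightarrow> T \<le> height z \<Longrightarrow> real d \<le> real j + Re \<alpha> \<Longrightarrow>
    norm (pow_deriv j \<alpha> z) \<le> norm (falling j \<alpha>) * exp (C * \<bar>Im \<alpha>\<bar>) * T powr - (Re \<alpha> + (real j - real d))"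
proof -
  obtain C where C: "\<And>z s. z \<in> half_plane \<theta> \<Longrightarrow>
      norm (branch_powr lg z s) \<le> norm z powr Re s * exp (C * \<bar>Im s\<bar>)"
    using norm_branch_powr_le by blast
  show ?thesis
  proof (rule that)
    fix z j \<alpha> and T :: real
    assume *: "0 < T" "T \<le> height z" "real d \<le> real j + Re \<alpha>"
    then have z: "z \<in> half_plane \<theta>" by (simp add: in_half_plane_iff)
    have "norm (branch_powr lg z (of_nat d - of_nat j - \<alpha>)) \<le>
        norm z powr - (Re \<alpha> + (real j - real d)) * exp (C * \<bar>Im \<alpha>\<bar>)"
      using C[OF z, of "of_nat d - of_nat j - \<alpha>"] by (simp add: algebra_simps)
    also have "\<dots> \<le> T powr - (Re \<alpha> + (real j - real d)) * exp (C * \<bar>Im \<alpha>\<bar>)"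
      using * height_le_norm[of z] by (intro mult_right_mono powr_mono2') auto
    finally show "norm (pow_deriv j \<alpha> z) \<le>
        norm (falling j \<alpha>) * exp (C * \<bar>Im \<alpha>\<bar>) * T powr - (Re \<alpha> + (real j - real d))"
      by (simp add: pow_deriv_def norm_mult mult_left_mono mult_ac)
  qed
qed

text \<open>Differentiation brings down \<open>d - j - \<alpha>\<close>, which is the next factor of
  \<open>falling\<close>.\<close>

lemma pow_deriv_DERIV:
  assumes "z \<in> half_plane \<theta>"
  shows "(pow_deriv j \<alpha> has_field_derivative pow_deriv (Suc j) \<alpha> z) (at z)"
proof -
  have "z \<noteq> 0" using assms by (auto simp: in_half_plane_iff height_def)
  have e: "exp (lg z) = z" using lg assms by (simp add: log_branch_on_def)
  let ?s = "of_nat d - of_nat j - \<alpha>"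
  have "((\<lambda>z. branch_powr lg z ?s) has_field_derivative exp (?s * lg z) * (?s * (1 / z))) (at z)"
    unfolding branch_powr_def
    by (rule derivative_eq_intros log_branch_DERIV[OF lg assms] refl)+ simp
  moreover have "exp (?s * lg z) * (?s * (1 / z)) = ?s * branch_powr lg z (of_nat d - of_nat (Suc j) - \<alpha>)"
  proof -
    have "(of_nat d - of_nat (Suc j) - \<alpha>) * lg z = ?s * lg z - lg z"
      by (simp add: algebra_simps)
    then show ?thesis by (simp add: branch_powr_def exp_diff e)
  qed
  ultimately have "((\<lambda>z. branch_powr lg z ?s) has_field_derivative
      ?s * branch_powr lg z (of_nat d - of_nat (Suc j) - \<alpha>)) (at z)" by simp
  from DERIV_cmult[OF this, of "falling j \<alpha>"] show ?thesis
    by (simp add: pow_deriv_def[abs_def] falling_def mult.assoc)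
qed

lemma holomorphic_pow_deriv [holomorphic_intros]: "(\<lambda>\<alpha>. pow_deriv j \<alpha> z) holomorphic_on A"
  unfolding pow_deriv_def falling_def branch_powr_def by (intro holomorphic_intros)

lemma holomorphic_em_remainder [holomorphic_intros]: "em_remainder M n holomorphic_on A"
  unfolding em_remainder_def[abs_def] G_op_def em_primitive_def by (intro holomorphic_intros)

section \<open>Taylor estimate of the remainder\<close>

lemma sum_triangle: "(\<Sum>m\<le>N. \<Sum>j\<le>N - m. f m j) = (\<Sum>k\<le>(N::nat). \<Sum>m\<le>k. f m (k - m) :: complex)"
proof -
  have "(\<Sum>m\<le>N. \<Sum>j\<le>N - m. f m j) = (\<Sum>(m, j)\<in>{(m, j). m + j \<le> N}. f m j)"
    by (subst sum.Sigma) (auto intro!: sum.cong)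
  then show ?thesis by (simp add: sum.triangle_reindex_eq)
qed

text \<open>Collecting terms by total order \<open>k = m + j\<close>, the coefficient of
  \<open>pow_deriv k\<close> is the convolution in \<open>G_op_power_convolution\<close>, so only
  \<open>k = d\<close> remains.\<close>

lemma pow_deriv_taylor_main_terms:
  "G_op d (\<lambda>x. \<Sum>m\<le>M. \<gamma> m * (\<Sum>j\<le>M + d - m. pow_deriv (m + j) \<alpha> y * x ^ j / fact j)) w = pow_deriv d \<alpha> y"
proof -
  let ?G = "\<lambda>j. G_op d (\<lambda>x. x ^ j) w / fact j"
  have "G_op d (\<lambda>x. \<Sum>m\<le>M. \<gamma> m * (\<Sum>j\<le>M + d - m. pow_deriv (m + j) \<alpha> y * x ^ j / fact j)) w =
      (\<Sum>m\<le>M. \<Sum>j\<le>M + d - m. \<gamma> m * (pow_deriv (m + j) \<alpha> y / fact j) * G_op d (\<lambda>x. x ^ j) w)"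
    unfolding G_op_sum[symmetric] G_op_cmult[symmetric] by (simp add: sum_distrib_left mult.assoc)
  also have "\<dots> = (\<Sum>m\<le>M. \<Sum>j\<le>M + d - m. pow_deriv (m + j) \<alpha> y * (\<gamma> m * ?G j))"
    by (simp add: mult_ac)
  \<comment> \<open>The added terms have \<open>m > M\<close>, hence
    \<open>j \<le> M + d - m < d\<close>, and there \<open>G_op\<close> annihilates the
    monomial.\<close>
  also have "\<dots> = (\<Sum>m\<le>M + d. \<Sum>j\<le>M + d - m. pow_deriv (m + j) \<alpha> y * (\<gamma> m * ?G j))"
    by (rule sum.mono_neutral_left) (auto simp: G_op_power intro!: sum.neutral)
  also have "\<dots> = (\<Sum>k\<le>M + d. \<Sum>m\<le>k. pow_deriv (m + (k - m)) \<alpha> y * (\<gamma> m * ?G (k - m)))"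
    by (rule sum_triangle)
  also have "\<dots> = (\<Sum>k\<le>M + d. pow_deriv k \<alpha> y * (\<Sum>m\<le>k. \<gamma> m * ?G (k - m)))"
    by (simp add: sum_distrib_left)
  also have "\<dots> = (\<Sum>k\<le>M + d. if k = d then pow_deriv k \<alpha> y else 0)"
    by (rule sum.cong[OF refl], subst G_op_power_convolution[OF w_nonzero]) auto
  finally show ?thesis by simp
qed

text \<open>After the Taylor main terms cancel, only derivatives of order \<open>M + d + 1\<close>
  of the power \<open>d - \<alpha>\<close> are left, and these have size \<open>weight\<close> to
  the power \<open>- (Re \<alpha> + M + 1)\<close>.\<close>

lemma norm_em_remainder_le:
  obtains D :: "complex \<Rightarrow> real" where "continuous_on UNIV D"
    "\<And>n \<alpha>. 0 \<le> Re \<alpha> + (real M + 1) \<Longrightarrow>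
      norm (em_remainder M n \<alpha>) \<le> D \<alpha> * weight d n powr - (Re \<alpha> + (real M + 1))"
proof -
  obtain \<delta> where \<delta>: "\<delta> > 0" "\<And>n. \<delta> * weight d n \<le> height (pt n)"
    using height_pt_ge by blast
  obtain C where C: "\<And>z j \<alpha> T. 0 < T \<Longrightarrow> T \<le> height z \<Longrightarrow> real d \<le> real j + Re \<alpha> \<Longrightarrow>
    norm (pow_deriv j \<alpha> z) \<le> norm (falling j \<alpha>) * exp (C * \<bar>Im \<alpha>\<bar>) * T powr - (Re \<alpha> + (real j - real d))"
    using norm_pow_deriv_le by blast
  define c where "c = (\<Sum>S\<in>Pow {1..d}. \<Sum>m\<le>M.
      norm (\<gamma> m) * (norm (\<Sum>i\<in>S. w i) ^ Suc (M + d - m) / fact (M + d - m)))"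
  define D where "D \<alpha> = norm (falling (Suc (M + d)) \<alpha>) * exp (C * \<bar>Im \<alpha>\<bar>) *
      \<delta> powr - (Re \<alpha> + (real M + 1)) * c" for \<alpha>
  show ?thesis
  proof (rule that)
    show "continuous_on UNIV D"
      unfolding D_def falling_def using \<delta>(1) by (intro continuous_intros) auto
  next
    fix n \<alpha> assume \<sigma>: "0 \<le> Re \<alpha> + (real M + 1)"
    define T where "T = \<delta> * weight d n"
    have T: "0 < T" "T \<le> height (pt n)"
      using \<delta> weight_ge_1[of d n] unfolding T_def by (auto intro: mult_pos_pos)
    \<comment> \<open>One bound serves all \<open>m\<close>: with Taylor length
      \<open>M + d - m\<close> each remainder involves the same derivative order
      \<open>Suc (M + d)\<close>.\<close>
    define B where "B = norm (falling (Suc (M + d)) \<alpha>) * exp (C * \<bar>Im \<alpha>\<bar>) * T powr - (Re \<alpha> + (real M + 1))"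
    have hB: "norm (pow_deriv (Suc (M + d)) \<alpha> z) \<le> B" if "T \<le> height z" for z
      using C[OF T(1) that, of "Suc (M + d)" \<alpha>] \<sigma> by (simp add: B_def algebra_simps)
    define r where "r m x = pow_deriv m \<alpha> (pt n + x) -
        (\<Sum>j\<le>M + d - m. pow_deriv (m + j) \<alpha> (pt n) * x ^ j / fact j)" for m x
    have r: "norm (r m (\<Sum>i\<in>S. w i)) \<le>
        B * (norm (\<Sum>i\<in>S. w i) ^ Suc (M + d - m) / fact (M + d - m))"
      if S: "S \<subseteq> {1..d}" and m: "m \<le> M" for m S
    proof -
      have "norm (pow_deriv (m + 0) \<alpha> (pt n + (\<Sum>i\<in>S. w i)) - (\<Sum>j\<le>M + d - m. pow_deriv (m + j) \<alpha> (pt n) *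
          ((pt n + (\<Sum>i\<in>S. w i)) - pt n) ^ j / fact j)) \<le>
        B * norm ((pt n + (\<Sum>i\<in>S. w i)) - pt n) ^ Suc (M + d - m) / fact (M + d - m)"
      \<comment> \<open>The region of height at least \<open>T\<close> is convex and contains both
        endpoints, because subset sums of the \<open>w i\<close> have nonnegative height.\<close>
      proof (rule complex_Taylor[where f = "\<lambda>i. pow_deriv (m + i) \<alpha>", OF convex_height_ge[of T]])
        show "(pow_deriv (m + i) \<alpha> has_field_derivative pow_deriv (m + Suc i) \<alpha> x) (at x within {z. T \<le> height z})"
          if "x \<in> {z. T \<le> height z}" for i x
          using pow_deriv_DERIV[of x "m + i" \<alpha>] that T(1)
          by (auto simp: in_half_plane_iff intro: has_field_derivative_at_within)
        show "norm (pow_deriv (m + Suc (M + d - m)) \<alpha> x) \<le> B" if "x \<in> {z. T \<le> height z}" for x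
          using hB that m by simp
        show "pt n + (\<Sum>i\<in>S. w i) \<in> {z. T \<le> height z}" "pt n \<in> {z. T \<le> height z}"
          using T sum_w_height[OF S] by (simp_all add: height_add)
      qed
      then show ?thesis by (simp add: r_def)
    qed
    have "G_op d (\<lambda>x. em_primitive M \<alpha> (pt n + x)) w =
        G_op d (\<lambda>x. (\<Sum>m\<le>M. \<gamma> m * (\<Sum>j\<le>M + d - m. pow_deriv (m + j) \<alpha> (pt n) * x ^ j / fact j))) w +
        G_op d (\<lambda>x. \<Sum>m\<le>M. \<gamma> m * r m x) w"
      unfolding G_op_def sum.distrib[symmetric] distrib_left[symmetric] em_primitive_def r_def by simp
    then have "em_remainder M n \<alpha> = - G_op d (\<lambda>x. \<Sum>m\<le>M. \<gamma> m * r m x) w"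
      unfolding pow_deriv_taylor_main_terms em_remainder_def by simp
    then have "norm (em_remainder M n \<alpha>) = norm (G_op d (\<lambda>x. \<Sum>m\<le>M. \<gamma> m * r m x) w)" by simp
    also have "\<dots> \<le> (\<Sum>S\<in>Pow {1..d}. \<Sum>m\<le>M. norm (\<gamma> m * r m (\<Sum>i\<in>S. w i)))"
      unfolding G_op_def
      by (intro sum_norm_le) (simp add: norm_mult[of "_ ^ _"] norm_power norm_sum)
    also have "\<dots> \<le> (\<Sum>S\<in>Pow {1..d}. \<Sum>m\<le>M.
        norm (\<gamma> m) * (B * (norm (\<Sum>i\<in>S. w i) ^ Suc (M + d - m) / fact (M + d - m))))"
      unfolding norm_mult by (intro sum_mono mult_left_mono r) auto
    also have "\<dots> = B * c"
      by (simp add: c_def sum_distrib_left mult_ac)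
    also have "\<dots> = D \<alpha> * weight d n powr - (Re \<alpha> + (real M + 1))"
      using \<delta>(1) weight_ge_1[of d n] by (simp add: B_def D_def T_def powr_mult mult_ac)
    finally show "norm (em_remainder M n \<alpha>) \<le> D \<alpha> * weight d n powr - (Re \<alpha> + (real M + 1))" .
  qed
qed

section \<open>Truncated continuations and their gluing\<close>

definition zeta_sum :: "complex \<Rightarrow> complex" where
  "zeta_sum \<alpha> = (\<Sum>\<^sub>\<infinity>n\<in>nat_tuples d. branch_powr lg (pt n) (- \<alpha>))"

definition cleared_zeta_trunc :: "nat \<Rightarrow> complex \<Rightarrow> complex" where
  "cleared_zeta_trunc M \<alpha> = (- 1) ^ d * em_primitive M \<alpha> a + (\<Sum>\<^sub>\<infinity>n\<in>nat_tuples d. em_remainder M n \<alpha>)"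

definition right_half :: "real \<Rightarrow> complex set" where
  "right_half c = {\<alpha>. c < Re \<alpha>}"

lemma right_half: "open (right_half c)" "connected (right_half c)" "right_half c \<noteq> {}"
proof -
  show "right_half c \<noteq> {}" unfolding right_half_def
    by (auto intro!: exI[of _ "of_real (c + 1)"])
qed (auto simp: right_half_def open_halfspace_Re_gt convex_halfspace_Re_gt convex_connected)

lemma pow_deriv_d: "pow_deriv d \<alpha> z = falling d \<alpha> * branch_powr lg z (- \<alpha>)"
  by (simp add: pow_deriv_def)

lemma falling_d_nonzero:
  assumes "\<And>k. k \<in> {1..d} \<Longrightarrow> \<alpha> \<noteq> of_nat k"
  shows "falling d \<alpha> \<noteq> 0"
proof -
  have "\<alpha> \<noteq> of_nat d - of_nat i" if "i < d" for i
    using assms[of "d - i"] that by (simp add: of_nat_diff)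
  then show ?thesis by (auto simp: falling_def)
qed

lemma falling_d_nonzero_right: "real d < Re \<alpha> \<Longrightarrow> falling d \<alpha> \<noteq> 0"
  by (rule falling_d_nonzero) auto

lemma falling_d_nonzero_ball: "\<alpha> \<in> ball 0 1 \<Longrightarrow> falling d \<alpha> \<noteq> 0"
  by (rule falling_d_nonzero) auto

lemma cleared_zeta_trunc_holomorphic: "cleared_zeta_trunc M holomorphic_on right_half (real d - 1 - real M)"
proof -
  obtain D :: "complex \<Rightarrow> real" where D: "continuous_on UNIV D"
    "\<And>n \<alpha>. 0 \<le> Re \<alpha> + (real M + 1) \<Longrightarrow>
      norm (em_remainder M n \<alpha>) \<le> D \<alpha> * weight d n powr - (Re \<alpha> + (real M + 1))"
    using norm_em_remainder_le by blast
  have "(\<lambda>\<alpha>. \<Sum>\<^sub>\<infinity>n\<in>nat_tuples d. em_remainder M n \<alpha>) holomorphic_on right_half (real d - 1 - real M)"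
    by (rule holomorphic_weighted_infsum(1)[OF d, where D = D and p = "real M + 1"])
       (use D(2) in \<open>auto simp: right_half_def open_halfspace_Re_gt intro!: holomorphic_em_remainder
         intro: continuous_on_subset[OF D(1)]\<close>)
  then show ?thesis
    unfolding cleared_zeta_trunc_def[abs_def] em_primitive_def by (intro holomorphic_intros)
qed

lemma zeta_sum:
  shows "zeta_sum holomorphic_on right_half (real d)"
    and "\<alpha> \<in> right_half (real d) \<Longrightarrow> (\<lambda>n. branch_powr lg (pt n) (- \<alpha>)) summable_on nat_tuples d"
proof -
  obtain \<delta> where \<delta>: "\<delta> > 0" "\<And>n. \<delta> * weight d n \<le> height (pt n)"
    using height_pt_ge by blast
  obtain C where C: "\<And>z s. z \<in> half_plane \<theta> \<Longrightarrow>
      norm (branch_powr lg z s) \<le> norm z powr Re s * exp (C * \<bar>Im s\<bar>)"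
    using norm_branch_powr_le by blast
  define D where "D \<alpha> = exp (C * \<bar>Im \<alpha>\<bar>) * \<delta> powr - Re \<alpha>" for \<alpha>
  have D: "continuous_on (right_half (real d)) D"
    unfolding D_def using \<delta>(1) by (intro continuous_intros) auto
  have bound: "norm (branch_powr lg (pt n) (- \<alpha>)) \<le> D \<alpha> * weight d n powr - (Re \<alpha> + 0)"
    if "\<alpha> \<in> right_half (real d)" for n \<alpha>
  proof -
    have pos: "\<delta> * weight d n > 0" using \<delta>(1) weight_ge_1[of d n] by (intro mult_pos_pos) auto
    have "norm (branch_powr lg (pt n) (- \<alpha>)) \<le> norm (pt n) powr - Re \<alpha> * exp (C * \<bar>Im \<alpha>\<bar>)"
      using C[OF pt_in_half_plane, of n "- \<alpha>"] by simp
    also have "norm (pt n) powr - Re \<alpha> \<le> (\<delta> * weight d n) powr - Re \<alpha>"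
      using pos \<delta>(2)[of n] height_le_norm[of "pt n"] that
      by (intro powr_mono2') (auto simp: right_half_def)
    finally show ?thesis
      using \<delta>(1) weight_ge_1[of d n] by (simp add: D_def powr_mult mult_ac mult_right_mono)
  qed
  have holo: "(\<lambda>\<alpha>. branch_powr lg (pt n) (- \<alpha>)) holomorphic_on right_half (real d)" for n
    unfolding branch_powr_def by (intro holomorphic_intros)
  note * = holomorphic_weighted_infsum[OF d right_half(1) _ holo D bound, simplified right_half_def, simplified]
  show "zeta_sum holomorphic_on right_half (real d)"
    using *(1) by (simp add: zeta_sum_def[abs_def] right_half_def)
  show "\<alpha> \<in> right_half (real d) \<Longrightarrow> (\<lambda>n. branch_powr lg (pt n) (- \<alpha>)) summable_on nat_tuples d"
    using *(3) by (simp add: right_half_def)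
qed

text \<open>For \<open>m = 0\<close> the exponent is \<open>d - \<alpha>\<close>, which loses
  \<open>d\<close> powers against the zeta summand; this is where \<open>2 * d\<close> comes
  from.\<close>

lemma pow_deriv_summable:
  assumes "2 * real d < Re \<alpha>"
  shows "(\<lambda>n. pow_deriv m \<alpha> (pt n)) summable_on nat_tuples d"
proof -
  obtain \<delta> where \<delta>: "\<delta> > 0" "\<And>n. \<delta> * weight d n \<le> height (pt n)"
    using height_pt_ge by blast
  obtain C where C: "\<And>z j \<alpha> T. 0 < T \<Longrightarrow> T \<le> height z \<Longrightarrow> real d \<le> real j + Re \<alpha> \<Longrightarrow>
    norm (pow_deriv j \<alpha> z) \<le> norm (falling j \<alpha>) * exp (C * \<bar>Im \<alpha>\<bar>) * T powr - (Re \<alpha> + (real j - real d))"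
    using norm_pow_deriv_le by blast
  define \<sigma> where "\<sigma> = Re \<alpha> + (real m - real d)"
  define c where "c = norm (falling m \<alpha>) * exp (C * \<bar>Im \<alpha>\<bar>) * \<delta> powr - \<sigma>"
  have "(\<lambda>n. norm (pow_deriv m \<alpha> (pt n))) summable_on nat_tuples d"
  proof (rule summable_on_comparison_test)
    show "(\<lambda>n. c * weight d n powr - \<sigma>) summable_on nat_tuples d"
      using assms by (intro summable_on_cmult_right summable_weight_powr d) (simp add: \<sigma>_def)
    fix n
    have "\<delta> * weight d n > 0" using \<delta>(1) weight_ge_1[of d n] by (intro mult_pos_pos) auto
    from C[OF this \<delta>(2), of m \<alpha>] assms
    show "norm (pow_deriv m \<alpha> (pt n)) \<le> c * weight d n powr - \<sigma>"
      using \<delta>(1) weight_ge_1[of d n] by (simp add: c_def \<sigma>_def powr_mult mult_ac)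
  qed auto
  then show ?thesis by (rule abs_summable_summable)
qed

text \<open>This far to the right the primitive itself is summable over the lattice, so its
  differences telescope to the boundary term at \<open>a\<close>.\<close>

lemma cleared_zeta_trunc_eq_far:
  assumes "2 * real d < Re \<alpha>"
  shows "cleared_zeta_trunc M \<alpha> = falling d \<alpha> * zeta_sum \<alpha>"
proof -
  define k where "k n = em_primitive M \<alpha> (pt n)" for n
  have "k summable_on nat_tuples d"
    unfolding k_def em_primitive_def
    by (rule has_sum_imp_summable[OF has_sum_sum], rule has_sum_infsum)
       (intro summable_on_cmult_right pow_deriv_summable assms)
  then have "((\<lambda>n. \<Sum>S\<in>Pow {1..d}. (- 1) ^ (d - card S) * k (shift_tuple d S n)) has_sum
      ((- 1) ^ d * k (\<lambda>i\<in>{1..d}. 0))) (nat_tuples d)"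
    by (rule has_sum_alternating_shifts)
  \<comment> \<open>Shifting the index by \<open>S\<close> adds the subset sum to the lattice
    point.\<close>
  also have "(\<lambda>n. \<Sum>S\<in>Pow {1..d}. (- 1) ^ (d - card S) * k (shift_tuple d S n)) =
      (\<lambda>n. G_op d (\<lambda>x. em_primitive M \<alpha> (pt n + x)) w)"
    by (auto simp: G_op_def k_def pt_def dot_shift_tuple add.assoc intro!: sum.cong)
  also have "k (\<lambda>i\<in>{1..d}. 0) = em_primitive M \<alpha> a"
    by (simp add: k_def pt_def dot_def)
  finally have 1: "((\<lambda>n. G_op d (\<lambda>x. em_primitive M \<alpha> (pt n + x)) w) has_sum ((- 1) ^ d * em_primitive M \<alpha> a)) (nat_tuples d)" .
  have "\<alpha> \<in> right_half (real d)" using assms by (simp add: right_half_def)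
  then have "((\<lambda>n. pow_deriv d \<alpha> (pt n)) has_sum (falling d \<alpha> * zeta_sum \<alpha>)) (nat_tuples d)"
    unfolding pow_deriv_d zeta_sum_def by (intro has_sum_cmult_right has_sum_infsum zeta_sum(2))
  from has_sum_add[OF this has_sum_uminusI[OF 1]] have "((\<lambda>n. em_remainder M n \<alpha>) has_sum
      (falling d \<alpha> * zeta_sum \<alpha> - (- 1) ^ d * em_primitive M \<alpha> a)) (nat_tuples d)"
    by (simp add: em_remainder_def)
  then show ?thesis by (simp add: cleared_zeta_trunc_def infsumI)
qed

text \<open>Both truncations agree far to the right; the identity theorem carries this to their
  common half-plane.\<close>

lemma cleared_zeta_trunc_unique:
  assumes "\<alpha> \<in> right_half (real d - 1 - real M)" "\<alpha> \<in> right_half (real d - 1 - real N)"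
  shows "cleared_zeta_trunc M \<alpha> = cleared_zeta_trunc N \<alpha>"
proof -
  let ?U = "right_half (max (real d - 1 - real M) (real d - 1 - real N))"
  show ?thesis
  proof (rule analytic_continuation_open[where f = "cleared_zeta_trunc M" and g = "cleared_zeta_trunc N" and z = \<alpha>])
    show "open (right_half (2 * real d))" "open ?U" "right_half (2 * real d) \<noteq> {}" "connected ?U"
      by (rule right_half)+
    show "right_half (2 * real d) \<subseteq> ?U" "\<alpha> \<in> ?U" using assms by (auto simp: right_half_def)
    show "cleared_zeta_trunc M holomorphic_on ?U" "cleared_zeta_trunc N holomorphic_on ?U"
      by (rule holomorphic_on_subset[OF cleared_zeta_trunc_holomorphic]; force simp: right_half_def)+
  qed (simp add: cleared_zeta_trunc_eq_far right_half_def)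
qed

lemma cleared_zeta_trunc_eq:
  assumes "real d < Re \<alpha>"
  shows "cleared_zeta_trunc M \<alpha> = falling d \<alpha> * zeta_sum \<alpha>"
proof (rule analytic_continuation_open[where f = "cleared_zeta_trunc M" and g = "\<lambda>\<alpha>. falling d \<alpha> * zeta_sum \<alpha>" and z = \<alpha>])
  show "open (right_half (2 * real d))" "open (right_half (real d))"
      "right_half (2 * real d) \<noteq> {}" "connected (right_half (real d))"
    by (rule right_half)+
  show "right_half (2 * real d) \<subseteq> right_half (real d)" "\<alpha> \<in> right_half (real d)"
    using assms by (auto simp: right_half_def)
  show "cleared_zeta_trunc M holomorphic_on right_half (real d)"
    by (rule holomorphic_on_subset[OF cleared_zeta_trunc_holomorphic]) (auto simp: right_half_def)
  show "(\<lambda>\<alpha>. falling d \<alpha> * zeta_sum \<alpha>) holomorphic_on right_half (real d)"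
    using zeta_sum(1) unfolding falling_def by (intro holomorphic_intros)
qed (simp add: cleared_zeta_trunc_eq_far right_half_def)

text \<open>The entire function \<open>(1 - \<alpha>) \<cdots> (d - \<alpha>) \<zeta>\<^sub>B(\<alpha>)\<close>.\<close>
definition cleared_zeta :: "complex \<Rightarrow> complex" where
  "cleared_zeta \<alpha> = cleared_zeta_trunc (nat \<lceil>\<bar>Re \<alpha>\<bar>\<rceil> + d) \<alpha>"

text \<open>The level chosen in \<open>cleared_zeta\<close> places \<open>\<alpha>\<close> at least
  1 inside its half-plane, and truncations agree wherever both are valid.\<close>

lemma cleared_zeta_eq: "\<alpha> \<in> right_half (real d - 1 - real M) \<Longrightarrow> cleared_zeta \<alpha> = cleared_zeta_trunc M \<alpha>"
  unfolding cleared_zeta_def by (rule cleared_zeta_trunc_unique) (auto simp: right_half_def, linarith)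

lemma cleared_zeta_holomorphic: "cleared_zeta holomorphic_on UNIV"
proof -
  have "cleared_zeta field_differentiable (at \<alpha>)" for \<alpha>
  proof -
    define M where "M = nat \<lceil>\<bar>Re \<alpha>\<bar>\<rceil> + d"
    let ?U = "right_half (real d - 1 - real M)"
    have "\<alpha> \<in> ?U" unfolding M_def right_half_def by (auto, linarith)
    moreover have "cleared_zeta holomorphic_on ?U"
      by (rule holomorphic_transform[OF cleared_zeta_trunc_holomorphic[of M]]) (simp add: cleared_zeta_eq)
    ultimately show ?thesis
      using right_half(1) holomorphic_on_imp_differentiable_at by blast
  qed
  then show ?thesis by (simp add: holomorphic_on_def)
qed

text \<open>Dividing the entire function by \<open>falling d\<close> gives existence,
  \<open>remove_sings\<close> supplies the required values at poles and removable points, and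
  agreement on a right half-plane gives uniqueness.\<close>

lemma barnes_zeta_eq: "barnes_zeta lg d w a = remove_sings (\<lambda>\<alpha>. cleared_zeta \<alpha> / falling d \<alpha>)"
  unfolding barnes_zeta_def
proof (rule the_equality)
  have "falling d holomorphic_on UNIV" unfolding falling_def[abs_def] by (intro holomorphic_intros)
  then have "(\<lambda>\<alpha>. cleared_zeta \<alpha> / falling d \<alpha>) meromorphic_on UNIV"
    using cleared_zeta_holomorphic
    by (intro meromorphic_intros analytic_on_imp_meromorphic_on) (auto simp: analytic_on_open)
  then have nice: "remove_sings (\<lambda>\<alpha>. cleared_zeta \<alpha> / falling d \<alpha>) nicely_meromorphic_on UNIV"
    by (rule remove_sings_nicely_meromorphic)
  have eq: "remove_sings (\<lambda>\<alpha>. cleared_zeta \<alpha> / falling d \<alpha>) \<alpha> =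
      (\<Sum>\<^sub>\<infinity>n\<in>nat_tuples d. branch_powr lg (a + dot d n w) (- \<alpha>))" if "real d < Re \<alpha>" for \<alpha>
  proof -
    have "(\<lambda>\<alpha>. cleared_zeta \<alpha> / falling d \<alpha>) holomorphic_on right_half (real d)"
      using \<open>falling d holomorphic_on UNIV\<close> cleared_zeta_holomorphic falling_d_nonzero_right
      by (intro holomorphic_intros) (auto simp: right_half_def intro: holomorphic_on_subset)
    then have "(\<lambda>\<alpha>. cleared_zeta \<alpha> / falling d \<alpha>) analytic_on {\<alpha>}"
      by (rule holomorphic_on_imp_analytic_at) (use that in \<open>auto simp: right_half_def open_halfspace_Re_gt\<close>)
    then have "remove_sings (\<lambda>\<alpha>. cleared_zeta \<alpha> / falling d \<alpha>) \<alpha> = cleared_zeta \<alpha> / falling d \<alpha>" by simp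
    also have "\<dots> = zeta_sum \<alpha>"
      using falling_d_nonzero_right[OF that] cleared_zeta_trunc_eq[OF that] by (simp add: cleared_zeta_def)
    finally show ?thesis by (simp add: zeta_sum_def pt_def)
  qed
  show *: "remove_sings (\<lambda>\<alpha>. cleared_zeta \<alpha> / falling d \<alpha>) nicely_meromorphic_on UNIV \<and>
    (\<forall>\<alpha>. Re \<alpha> > real d \<longrightarrow> remove_sings (\<lambda>\<alpha>. cleared_zeta \<alpha> / falling d \<alpha>) \<alpha> =
        (\<Sum>\<^sub>\<infinity>n\<in>nat_tuples d. branch_powr lg (a + dot d n w) (- \<alpha>)))"
    using nice eq by blast
  fix f
  assume f: "f nicely_meromorphic_on UNIV \<and> (\<forall>\<alpha>. Re \<alpha> > real d \<longrightarrow> f \<alpha> =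
        (\<Sum>\<^sub>\<infinity>n\<in>nat_tuples d. branch_powr lg (a + dot d n w) (- \<alpha>)))"
  show "f = remove_sings (\<lambda>\<alpha>. cleared_zeta \<alpha> / falling d \<alpha>)"
    by (rule nicely_meromorphic_eqI[OF _ nice right_half(1,3)[of "real d"]])
       (use f eq in \<open>auto simp: right_half_def\<close>)
qed

section \<open>The derivative at 0\<close>

text \<open>Splits \<open>(1 - \<alpha>) ... (d - \<alpha>)\<close> into its top \<open>j\<close>
  factors and the rest, so that \<open>falling j\<close> can be cancelled from
  \<open>pow_deriv j \<alpha> z / falling d \<alpha>\<close>.\<close>

lemma falling_mult_prod:
  "j \<le> d \<Longrightarrow> falling j \<alpha> * (\<Prod>i=1..d - j. of_nat i - \<alpha>) = (\<Prod>i=1..d. of_nat i - \<alpha>)"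
proof (induction j)
  case 0
  then show ?case by (simp add: falling_def)
next
  case (Suc j)
  then have "d - j = Suc (d - Suc j)" by simp
  then have "(\<Prod>i=1..d - j. of_nat i - \<alpha>) = (\<Prod>i=1..d - Suc j. of_nat i - \<alpha>) * (of_nat (d - j) - \<alpha>)"
    by (simp add: mult.commute)
  with Suc show ?case by (simp add: falling_def of_nat_diff mult_ac)
qed

text \<open>The logarithmic derivative of the product at 0 is \<open>- harm k\<close>; this is the
  source of the harmonic numbers.\<close>

lemma prod_DERIV_0:
  "((\<lambda>\<alpha>. \<Prod>i=1..k. of_nat i - \<alpha>) has_field_derivative - fact k * harm k) (at (0 :: complex))"
proof (induction k)
  case (Suc k)
  have *: "((\<lambda>\<alpha>. of_nat (Suc k) - \<alpha>) has_field_derivative - 1) (at (0 :: complex))"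
    by (auto intro!: derivative_eq_intros)
  have P0: "(\<Prod>i=1..k. of_nat i - 0 :: complex) = fact k"
    by (simp add: fact_prod)
  have eq: "- fact k * harm k * (of_nat (Suc k) - 0) + - 1 * fact k = - fact (Suc k) * (harm (Suc k) :: complex)"
    by (simp add: harm_Suc fact_Suc field_simps del: of_nat_Suc)
  have "(\<lambda>\<alpha> :: complex. \<Prod>i=1..Suc k. of_nat i - \<alpha>) = (\<lambda>\<alpha>. (\<Prod>i=1..k. of_nat i - \<alpha>) * (of_nat (Suc k) - \<alpha>))"
    by (simp add: fun_eq_iff)
  then show ?case
    using DERIV_mult[OF Suc *] unfolding P0 eq by (simp only:)
qed (simp add: harm_def)

lemma pow_deriv_div_DERIV_0:
  assumes m: "m \<le> d"
  shows "((\<lambda>\<alpha>. pow_deriv m \<alpha> z / falling d \<alpha>) has_field_derivative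
    branch_powr lg z (of_nat (d - m)) / fact (d - m) * (harm (d - m) - lg z)) (at 0)"
proof -
  define k where "k = d - m"
  define P where "P = (\<lambda>\<alpha> :: complex. \<Prod>i=1..k. of_nat i - \<alpha>)"
  have P0: "P 0 = fact k" by (simp add: P_def fact_prod)
  have "((\<lambda>\<alpha>. branch_powr lg z (of_nat k - \<alpha>)) has_field_derivative
      branch_powr lg z (of_nat k) * (- lg z)) (at 0)"
    unfolding branch_powr_def by (auto intro!: derivative_eq_intros)
  from DERIV_divide[OF this prod_DERIV_0[of k, folded P_def]]
  have "((\<lambda>\<alpha>. branch_powr lg z (of_nat k - \<alpha>) / P \<alpha>) has_field_derivative
      (branch_powr lg z (of_nat k) * - lg z * fact k - branch_powr lg z (of_nat k) * (- fact k * harm k)) /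
      (fact k * fact k)) (at 0)"
    by (simp add: P0)
  also have "(branch_powr lg z (of_nat k) * - lg z * fact k - branch_powr lg z (of_nat k) * (- fact k * harm k)) /
      (fact k * fact k) = fact k * (branch_powr lg z (of_nat k) * (harm k - lg z)) / (fact k * fact k)"
    by (simp add: algebra_simps)
  also have "\<dots> = branch_powr lg z (of_nat k) / fact k * (harm k - lg z)"
    by simp
  finally have D: "((\<lambda>\<alpha>. branch_powr lg z (of_nat k - \<alpha>) / P \<alpha>) has_field_derivative
      branch_powr lg z (of_nat k) / fact k * (harm k - lg z)) (at 0)" .
  \<comment> \<open>On the unit disc \<open>falling d\<close> has no zero, so the cancellation is
    legitimate there.\<close>
  have "eventually (\<lambda>\<alpha> :: complex. \<alpha> \<in> ball 0 1) (nhds 0)"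
    by (intro eventually_nhds_in_open) auto
  then have ev: "eventually (\<lambda>\<alpha>. pow_deriv m \<alpha> z / falling d \<alpha> = branch_powr lg z (of_nat k - \<alpha>) / P \<alpha>) (nhds 0)"
  proof eventually_elim
    case (elim \<alpha>)
    have "falling d \<alpha> = falling m \<alpha> * P \<alpha>"
      using falling_mult_prod[OF m, of \<alpha>] falling_mult_prod[of d \<alpha>] by (simp add: P_def k_def)
    then show ?case
      using falling_d_nonzero_ball[OF elim] m by (simp add: pow_deriv_def k_def of_nat_diff)
  qed
  show ?thesis
    using DERIV_cong_ev[THEN iffD2, OF refl ev refl D] by (simp only: k_def)
qed

lemma branch_powr_of_nat: "z \<in> half_plane \<theta> \<Longrightarrow> branch_powr lg z (of_nat k) = z ^ k"
  using lg by (simp add: branch_powr_def exp_of_nat_mult log_branch_on_def)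

lemma em_primitive_div_DERIV_0:
  assumes "z \<in> half_plane \<theta>"
  shows "((\<lambda>\<alpha>. em_primitive d \<alpha> z / falling d \<alpha>) has_field_derivative
    (\<Sum>m\<le>d. \<gamma> m * (z ^ (d - m) / fact (d - m) * (harm (d - m) - lg z)))) (at 0)"
proof -
  have "((\<lambda>\<alpha>. \<Sum>m\<le>d. \<gamma> m * (pow_deriv m \<alpha> z / falling d \<alpha>)) has_field_derivative
    (\<Sum>m\<le>d. \<gamma> m * (z ^ (d - m) / fact (d - m) * (harm (d - m) - lg z)))) (at 0)"
    using pow_deriv_div_DERIV_0[of _ z, unfolded branch_powr_of_nat[OF assms]]
    by (intro DERIV_sum DERIV_cmult) simp
  then show ?thesis by (simp add: em_primitive_def sum_divide_distrib)
qed

lemma bernoullian_deriv0: "bernoullian_deriv0 d w m = fact m * \<gamma> m"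
  by (rule bernoullian_deriv0_eq[OF d]) (rule w_nonzero)

definition summand :: "(nat \<Rightarrow> nat) \<Rightarrow> complex" where
  "summand n = - lg (pt n) - harm d +
    (\<Sum>m=0..d. bernoullian_deriv0 d w m / (fact m * fact (d - m)) *
       G_op d (\<lambda>x. (pt n + x) ^ (d - m) * lg (pt n + x)) w)"

text \<open>For \<open>m > 0\<close> the polynomial has degree below \<open>d\<close> and is
  annihilated. At \<open>m = 0\<close> the factor \<open>fact d\<close> and the product of the
  \<open>w i\<close> cancel against the denominator and \<open>\<gamma> 0\<close>.\<close>

lemma G_op_harm_terms:
  "(\<Sum>m\<le>d. \<gamma> m * (harm (d - m) / fact (d - m) * G_op d (\<lambda>x. (y + x) ^ (d - m)) w)) = harm d"
proof -
  have "(\<Sum>m\<le>d. \<gamma> m * (harm (d - m) / fact (d - m) * G_op d (\<lambda>x. (y + x) ^ (d - m)) w)) =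
      (\<Sum>m\<le>d. if m = 0 then harm d else 0)"
  proof (rule sum.cong)
    fix m assume "m \<in> {..d}"
    then have "G_op d (\<lambda>x. (y + x) ^ (d - m)) w = (if m = 0 then fact d * (\<Prod>i=1..d. w i) else 0)"
      using d by (subst G_op_shifted_power) auto
    then show "\<gamma> m * (harm (d - m) / fact (d - m) * G_op d (\<lambda>x. (y + x) ^ (d - m)) w) =
        (if m = 0 then harm d else 0)"
      using w_nonzero by (simp add: bernoulli_fps_nth_0)
  qed simp
  then show ?thesis by simp
qed

text \<open>The first term contributes \<open>- lg (pt n)\<close> because \<open>harm 0 = 0\<close>;
  the \<open>G_op\<close> part splits into logarithmic terms and harmonic terms, the latter adding
  up to \<open>harm d\<close>.\<close>

lemma em_remainder_div_DERIV_0: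
  "((\<lambda>\<alpha>. em_remainder d n \<alpha> / falling d \<alpha>) has_field_derivative summand n) (at 0)"
proof -
  let ?y = "pt n"
  let ?g = "\<lambda>z. \<Sum>m\<le>d. \<gamma> m * (z ^ (d - m) / fact (d - m) * (harm (d - m) - lg z))"
  have "((\<lambda>\<alpha>. G_op d (\<lambda>x. em_primitive d \<alpha> (?y + x) / falling d \<alpha>) w) has_field_derivative
      G_op d (\<lambda>x. ?g (?y + x)) w) (at 0)"
    unfolding G_op_def
    by (intro DERIV_sum DERIV_cmult em_primitive_div_DERIV_0 pt_add_in_half_plane) auto
  from DERIV_diff[OF pow_deriv_div_DERIV_0[of d ?y] this]
  have "((\<lambda>\<alpha>. pow_deriv d \<alpha> ?y / falling d \<alpha> - G_op d (\<lambda>x. em_primitive d \<alpha> (?y + x) / falling d \<alpha>) w) has_field_derivative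
      - lg ?y - G_op d (\<lambda>x. ?g (?y + x)) w) (at 0)"
    by (simp add: branch_powr_def harm_def)
  moreover have "pow_deriv d \<alpha> ?y / falling d \<alpha> - G_op d (\<lambda>x. em_primitive d \<alpha> (?y + x) / falling d \<alpha>) w = em_remainder d n \<alpha> / falling d \<alpha>" for \<alpha>
    by (simp add: em_remainder_def G_op_def diff_divide_distrib sum_divide_distrib)
  moreover have "G_op d (\<lambda>x. ?g (?y + x)) w =
      (\<Sum>m\<le>d. \<gamma> m * (harm (d - m) / fact (d - m) * G_op d (\<lambda>x. (?y + x) ^ (d - m)) w)) -
      (\<Sum>m\<le>d. \<gamma> m / fact (d - m) * G_op d (\<lambda>x. (?y + x) ^ (d - m) * lg (?y + x)) w)"
    unfolding G_op_sum[symmetric] G_op_cmult[symmetric] G_op_diff[symmetric] sum_subtractf[symmetric]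
    by (simp add: algebra_simps diff_divide_distrib)
  ultimately show ?thesis
    unfolding G_op_harm_terms by (simp add: summand_def bernoullian_deriv0 atMost_atLeast0 diff_diff_eq2 diff_add_eq)
qed

text \<open>At level \<open>M = d\<close> the decay exponent \<open>Re \<alpha> + d + 1\<close>
  exceeds \<open>d\<close> on the unit disc, so differentiation at 0 passes inside the sum.\<close>

lemma summand_has_sum:
  "(summand has_sum deriv (\<lambda>\<alpha>. \<Sum>\<^sub>\<infinity>n\<in>nat_tuples d. em_remainder d n \<alpha> / falling d \<alpha>) 0) (nat_tuples d)"
  "((\<lambda>\<alpha>. \<Sum>\<^sub>\<infinity>n\<in>nat_tuples d. em_remainder d n \<alpha> / falling d \<alpha>) has_field_derivative
     (\<Sum>\<^sub>\<infinity>n\<in>nat_tuples d. summand n)) (at 0)"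
proof -
  obtain D :: "complex \<Rightarrow> real" where D: "continuous_on UNIV D"
    "\<And>n \<alpha>. 0 \<le> Re \<alpha> + (real d + 1) \<Longrightarrow>
      norm (em_remainder d n \<alpha>) \<le> D \<alpha> * weight d n powr - (Re \<alpha> + (real d + 1))"
    using norm_em_remainder_le by blast
  have Re: "- 1 < Re \<alpha>" if "\<alpha> \<in> ball 0 1" for \<alpha>
    using that abs_Re_le_cmod[of \<alpha>] by (auto simp: dist_norm)
  have holo: "(\<lambda>\<alpha>. em_remainder d n \<alpha> / falling d \<alpha>) holomorphic_on ball 0 1" for n
    using falling_d_nonzero_ball unfolding falling_def by (intro holomorphic_intros) auto
  have cont: "continuous_on (ball 0 1) (\<lambda>\<alpha>. D \<alpha> / norm (falling d \<alpha>))"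
    using falling_d_nonzero_ball continuous_on_subset[OF D(1)] unfolding falling_def
    by (intro continuous_intros) auto
  have bound: "norm (em_remainder d n \<alpha> / falling d \<alpha>) \<le> D \<alpha> / norm (falling d \<alpha>) * weight d n powr - (Re \<alpha> + (real d + 1))"
    if "\<alpha> \<in> ball 0 1" for n \<alpha>
    using D(2)[of \<alpha> n] Re[OF that] by (simp add: norm_divide divide_right_mono)
  have Re': "real d < Re \<alpha> + (real d + 1)" if "\<alpha> \<in> ball 0 1" for \<alpha>
    using Re[OF that] by simp
  note * = holomorphic_weighted_infsum[OF d open_ball Re' holo cont bound]
  have "deriv (\<lambda>\<alpha>. em_remainder d n \<alpha> / falling d \<alpha>) 0 = summand n" for n
    by (rule DERIV_imp_deriv[OF em_remainder_div_DERIV_0])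
  then show 1: "(summand has_sum deriv (\<lambda>\<alpha>. \<Sum>\<^sub>\<infinity>n\<in>nat_tuples d. em_remainder d n \<alpha> / falling d \<alpha>) 0) (nat_tuples d)"
    using *(2)[of 0] by simp
  have "((\<lambda>\<alpha>. \<Sum>\<^sub>\<infinity>n\<in>nat_tuples d. em_remainder d n \<alpha> / falling d \<alpha>) has_field_derivative
     deriv (\<lambda>\<alpha>. \<Sum>\<^sub>\<infinity>n\<in>nat_tuples d. em_remainder d n \<alpha> / falling d \<alpha>) 0) (at 0)"
    by (rule holomorphic_derivI[OF *(1) open_ball]) auto
  then show "((\<lambda>\<alpha>. \<Sum>\<^sub>\<infinity>n\<in>nat_tuples d. em_remainder d n \<alpha> / falling d \<alpha>) has_field_derivative
     (\<Sum>\<^sub>\<infinity>n\<in>nat_tuples d. summand n)) (at 0)"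
    using infsumI[OF 1] by simp
qed

lemma barnes_zeta_DERIV_0:
  "(barnes_zeta lg d w a has_field_derivative
     ((- 1) ^ (d + 1) *
        (\<Sum>m=0..d. bernoullian_deriv0 d w m * a ^ (d - m) / (fact m * fact (d - m)) *
           (lg a - harm (d - m)))
      + (\<Sum>\<^sub>\<infinity>n\<in>nat_tuples d. summand n))) (at 0)"
proof -
  let ?F = "\<lambda>\<alpha>. (- 1) ^ d * (em_primitive d \<alpha> a / falling d \<alpha>) + (\<Sum>\<^sub>\<infinity>n\<in>nat_tuples d. em_remainder d n \<alpha> / falling d \<alpha>)"
  have "eventually (\<lambda>\<alpha> :: complex. \<alpha> \<in> ball 0 1) (nhds 0)"
    by (intro eventually_nhds_in_open) auto
  then have ev: "eventually (\<lambda>\<alpha>. barnes_zeta lg d w a \<alpha> = ?F \<alpha>) (nhds 0)"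
  proof eventually_elim
    case (elim \<alpha>)
    have "(\<lambda>\<alpha>. cleared_zeta \<alpha> / falling d \<alpha>) holomorphic_on ball 0 1"
      using cleared_zeta_holomorphic falling_d_nonzero_ball unfolding falling_def
      by (intro holomorphic_intros) (auto intro: holomorphic_on_subset)
    then have "(\<lambda>\<alpha>. cleared_zeta \<alpha> / falling d \<alpha>) analytic_on {\<alpha>}"
      by (rule holomorphic_on_imp_analytic_at) (use elim in auto)
    then have "barnes_zeta lg d w a \<alpha> = cleared_zeta \<alpha> / falling d \<alpha>"
      by (simp add: barnes_zeta_eq)
    \<comment> \<open>Level \<open>d\<close> is valid for \<open>Re \<alpha> > - 1\<close>, which
      covers the unit disc.\<close>
    also have "cleared_zeta \<alpha> = cleared_zeta_trunc d \<alpha>"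
      using elim abs_Re_le_cmod[of \<alpha>] by (intro cleared_zeta_eq) (auto simp: right_half_def)
    also have "\<dots> / falling d \<alpha> = ?F \<alpha>"
      unfolding cleared_zeta_trunc_def divide_inverse infsum_cmult_left' by (simp add: distrib_right)
    finally show ?case .
  qed
  have "(?F has_field_derivative
      (- 1) ^ d * (\<Sum>m\<le>d. \<gamma> m * (a ^ (d - m) / fact (d - m) * (harm (d - m) - lg a))) +
      (\<Sum>\<^sub>\<infinity>n\<in>nat_tuples d. summand n)) (at 0)"
    by (intro DERIV_add DERIV_cmult em_primitive_div_DERIV_0 a summand_has_sum(2))
  \<comment> \<open>Reversing the difference to \<open>lg a - harm (d - m)\<close> costs the extra
    sign.\<close>
  also have "(- 1) ^ d * (\<Sum>m\<le>d. \<gamma> m * (a ^ (d - m) / fact (d - m) * (harm (d - m) - lg a))) =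
      (- 1) ^ (d + 1) * (\<Sum>m=0..d. bernoullian_deriv0 d w m * a ^ (d - m) / (fact m * fact (d - m)) *
           (lg a - harm (d - m)))"
    unfolding bernoullian_deriv0 atMost_atLeast0 sum_distrib_left
    by (rule sum.cong) (simp_all add: field_simps)
  finally show ?thesis
    using DERIV_cong_ev[OF refl ev refl] by simp
qed

end

theorem mainTheorem3:
  fixes \<theta> :: real and lg :: "complex \<Rightarrow> complex"
    and d :: nat and a :: complex and w :: "nat \<Rightarrow> complex"
    and term_at :: "(nat \<Rightarrow> nat) \<Rightarrow> complex"
  assumes "log_branch_on lg (half_plane \<theta>)"
    and "d \<ge> 1"
    and "a \<in> half_plane \<theta>"
    and "\<And>i. i \<in> {1..d} \<Longrightarrow> w i \<in> half_plane \<theta>"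
  defines "term_at \<equiv> \<lambda>n.
      - lg (a + dot d n w) - harm d
      + (\<Sum>m=0..d. bernoullian_deriv0 d w m / (fact m * fact (d - m)) *
           G_op d (\<lambda>x. (a + dot d n w + x) ^ (d - m) * lg (a + dot d n w + x)) w)"
  shows "(\<lambda>n. norm (term_at n)) summable_on nat_tuples d \<and>
         (barnes_zeta lg d w a has_field_derivative
            ((- 1) ^ (d + 1) *
               (\<Sum>m=0..d. bernoullian_deriv0 d w m * a ^ (d - m) / (fact m * fact (d - m)) *
                  (lg a - harm (d - m)))
             + (\<Sum>\<^sub>\<infinity>n\<in>nat_tuples d. term_at n))) (at 0)"
proof -
  interpret barnes \<theta> lg d w a
    by unfold_locales (use assms(1-4) in auto)
  have "term_at = summand"
    by (simp add: term_at_def summand_def pt_def fun_eq_iff)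
  \<comment> \<open>For complex families unconditional and absolute summability coincide, which
    settles the first conjunct.\<close>
  moreover have "summand summable_on nat_tuples d"
    using summand_has_sum(1) by (rule has_sum_imp_summable)
  ultimately show ?thesis
    using barnes_zeta_DERIV_0 by (simp add: summable_on_iff_abs_summable_on_complex)
qed

end
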